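(* The natural map $$i:K_0(\mathrm{Var}_{\mathbb R})\longrightarrow K_0(BSA_{\mathbb R})$$ that associates to an affine real algebraic variety its value in the Grothendieck ring $K_0(BSA_{\mathbb R})$ of basic real semialgebraic formulas is an injective morphism.
   Context: **The ring $K_0(\mathrm{Var}_{\mathbb R})$.** An affine algebraic variety over $\mathbb R$ is an affine reduced separated scheme of finite type over $\mathbb R$, given by finitely many real polynomial equations in some affine space $\mathbb A^n$; a Zariski-constructible variety is given by finitely many real polynomial equations $P_i=0$ and inequations $Q_j\neq 0$. $K_0(\mathrm{Var}_{\mathbb R})$ is the abelian group generated by isomorphism classes $[X]$ of Zariski-constructible real algebraic varieties, subject to $[X]=[Y]+[X\setminus Y]$ for $Y\subset X$ a closed subvariety, with ring structure induced by the product of constructible sets. (These are classes of varieties over $\mathbb R$, not merely of their sets of real points.) **The ring $K_0(BSA_{\mathbb R})$.** A basic semialgebraic formula $A$ in $n$ variables is a finite system of conditions $\{P_i=0,\ Q_j\neq 0,\ R_k>0,\ i=1,\dots,p,\ j=1,\dots,q,\ k=1,\dots,r\}$ with $P_i,Q_j,R_k\in\mathbb R[X_1,\dots,X_n]$; conditions $Q_j\neq0$ are called inequations and $R_k>0$ inequalities. The formula itself, not its set of real solutions, is the object considered. $\{A,B\}$ denotes the conjunction of $A$ and $B$. $K_0(BSA_{\mathbb R})$ is the free commutative ring generated by symbols $[A]$, $A$ a basic semialgebraic formula, where formulas without inequality are taken up to algebraic isomorphism (of the underlying constructible varieties over $\mathbb R$), subject to: (1) $[A]=[A,S=0]+[A,S\neq0]$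 for $A$ a formula in $n$ variables and $S\in\mathbb R[X_1,\dots,X_n]$; (2) $[A,R\neq0]=[A,R>0]+[A,-R>0]$ for $A$ a formula in $n$ variables and $R\in\mathbb R[X_1,\dots,X_n]$; (3) $[A,B]=[A]\cdot[B]$ for formulas $A,B$ with disjoint sets of variables. The map $i$ sends the class of a constructible variety to the class of the inequality-free formula (equations and inequations) defining it. *)

theory Defs
  imports Complex_Main "HOL-Library.Multiset" "HOL-Library.Poly_Mapping" "HOL-Algebra.Generated_Groups" "HOL-Algebra.QuotRing"
begin

section \<open>Polynomial rings and free commutative rings\<close>

text \<open>
  The commutative polynomial ring with coefficients in the type \<open>'k\<close> and with
  indeterminates indexed by the set \<open>V\<close>. A monomial is the multiset of the indices of its factors.
  For integer coefficients this is the free commutative (unital) ring on the set \<open>V\<close>.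
\<close>

definition mpoly_ring :: "'v set \<Rightarrow> ('v multiset \<Rightarrow>\<^sub>0 'k::comm_ring_1) ring" where
  "mpoly_ring V =
     \<lparr>carrier = {p. \<forall>m \<in> Poly_Mapping.keys p. set_mset m \<subseteq> V},
      mult = (*), one = 1, zero = 0, add = (+)\<rparr>"

type_synonym rpoly = "nat multiset \<Rightarrow>\<^sub>0 real"

text \<open>The ring \<open>\<real>[X\<^sub>0, \<dots>, X\<^sub>n\<^sub>-\<^sub>1]\<close>.\<close>

definition rpoly_ring :: "nat \<Rightarrow> rpoly ring" where
  "rpoly_ring n = mpoly_ring {..<n}"

definition rconst :: "real \<Rightarrow> rpoly" where
  "rconst c = Poly_Mapping.single {#} c"

definition rvar :: "nat \<Rightarrow> rpoly" where
  "rvar i = Poly_Mapping.single {#i#} 1"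

text \<open>Substitution of \<open>X\<^bsub>\<sigma> i\<^esub>\<close> for \<open>X\<^sub>i\<close>.\<close>

definition rename :: "(nat \<Rightarrow> nat) \<Rightarrow> rpoly \<Rightarrow> rpoly" where
  "rename \<sigma> p =
     (\<Sum>m \<in> Poly_Mapping.keys p. Poly_Mapping.single (image_mset \<sigma> m) (Poly_Mapping.lookup p m))"

section \<open>Basic semialgebraic formulas\<close>

text \<open>
  \<open>Formula n P Q R\<close> is the formula in \<open>n\<close> variables with the equations \<open>p = 0\<close> (\<open>p \<in> P\<close>), the
  inequations \<open>q \<noteq> 0\<close> (\<open>q \<in> Q\<close>) and the inequalities \<open>r > 0\<close> (\<open>r \<in> R\<close>).
\<close>

datatype bsa_formula =
  Formula (nvars: nat) (eqs: "rpoly set") (ineqs: "rpoly set") (pos: "rpoly set")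

definition bsa_formulas :: "bsa_formula set" where
  "bsa_formulas = {A.
     finite (eqs A) \<and> eqs A \<subseteq> carrier (rpoly_ring (nvars A)) \<and>
     finite (ineqs A) \<and> ineqs A \<subseteq> carrier (rpoly_ring (nvars A)) \<and>
     finite (pos A) \<and> pos A \<subseteq> carrier (rpoly_ring (nvars A))}"

definition with_eq :: "bsa_formula \<Rightarrow> rpoly \<Rightarrow> bsa_formula" where
  "with_eq A S = Formula (nvars A) (insert S (eqs A)) (ineqs A) (pos A)"

definition with_ineq :: "bsa_formula \<Rightarrow> rpoly \<Rightarrow> bsa_formula" where
  "with_ineq A S = Formula (nvars A) (eqs A) (insert S (ineqs A)) (pos A)"

definition with_pos :: "bsa_formula \<Rightarrow> rpoly \<Rightarrow> bsa_formula" where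
  "with_pos A S = Formula (nvars A) (eqs A) (ineqs A) (insert S (pos A))"

text \<open>
  The conjunction of \<open>A\<close>, written in the variables \<open>X\<^bsub>\<sigma> i\<^esub>\<close>, and of \<open>B\<close>, written in the
  variables \<open>X\<^bsub>\<tau> j\<^esub>\<close>, when these two sets of variables are disjoint and together are
  \<open>X\<^sub>0, \<dots>, X\<^bsub>nvars A + nvars B - 1\<^esub>\<close>.
\<close>

definition join :: "(nat \<Rightarrow> nat) \<Rightarrow> bsa_formula \<Rightarrow> (nat \<Rightarrow> nat) \<Rightarrow> bsa_formula \<Rightarrow> bsa_formula" where
  "join \<sigma> A \<tau> B = Formula (nvars A + nvars B)
     (rename \<sigma> ` eqs A \<union> rename \<tau> ` eqs B)
     (rename \<sigma> ` ineqs A \<union> rename \<tau> ` ineqs B)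
     (rename \<sigma> ` pos A \<union> rename \<tau> ` pos B)"

definition empty_formula :: bsa_formula where
  "empty_formula = Formula 0 {} {} {}"

section \<open>Constructible varieties over the reals\<close>

definition constructible_varieties :: "bsa_formula set" where
  "constructible_varieties = {X \<in> bsa_formulas. pos X = {}}"

text \<open>The underlying set of the variety, as a locally closed set of scheme points of
  \<open>Spec \<real>[X\<^sub>0, \<dots>, X\<^sub>n\<^sub>-\<^sub>1]\<close>.\<close>

definition locus :: "bsa_formula \<Rightarrow> rpoly set set" where
  "locus X = {\<pp>. primeideal \<pp> (rpoly_ring (nvars X)) \<and> eqs X \<subseteq> \<pp> \<and> ineqs X \<inter> \<pp> = {}}"

definition radical :: "('a, 'b) ring_scheme \<Rightarrow> 'a set \<Rightarrow> 'a set" where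
  "radical R I = {f \<in> carrier R. \<exists>k::nat. f [^]\<^bsub>R\<^esub> k \<in> I}"

text \<open>
  The affine reduced scheme given by \<open>P = 0\<close>, \<open>Q \<noteq> 0\<close> is the spectrum of the localisation of the
  reduced ring \<open>\<real>[X]/\<surd>(P)\<close> at the product \<open>q\<close> of the elements of \<open>Q\<close>. This localisation is
  \<open>\<real>[X, T]/\<surd>(P, T q - 1)\<close>, where here \<open>T = X\<^sub>n\<close>.
\<close>

definition coord_ideal :: "bsa_formula \<Rightarrow> rpoly set" where
  "coord_ideal X =
     (let R = rpoly_ring (Suc (nvars X))
      in radical R (Idl\<^bsub>R\<^esub> (eqs X \<union> {rvar (nvars X) * (\<Prod>q \<in> ineqs X. q) - 1})))"

definition coord_ring :: "bsa_formula \<Rightarrow> rpoly set ring" where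
  "coord_ring X = rpoly_ring (Suc (nvars X)) Quot coord_ideal X"

definition coord_const :: "bsa_formula \<Rightarrow> real \<Rightarrow> rpoly set" where
  "coord_const X c = coord_ideal X +>\<^bsub>rpoly_ring (Suc (nvars X))\<^esub> rconst c"

text \<open>Isomorphisms of affine schemes over \<open>\<real>\<close> are the isomorphisms of \<open>\<real>\<close>-algebras between the
  coordinate rings, in the opposite direction.\<close>

definition iso_over_real :: "bsa_formula \<Rightarrow> bsa_formula \<Rightarrow> bool" where
  "iso_over_real X Y \<longleftrightarrow>
     (\<exists>h \<in> ring_iso (coord_ring Y) (coord_ring X). \<forall>c. h (coord_const Y c) = coord_const X c)"

definition closed_subvariety :: "bsa_formula \<Rightarrow> bsa_formula \<Rightarrow> bool" where
  "closed_subvariety Y X \<longleftrightarrow>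
     nvars Y = nvars X \<and>
     (\<exists>S. finite S \<and> S \<subseteq> carrier (rpoly_ring (nvars X)) \<and> locus Y = {\<pp> \<in> locus X. S \<subseteq> \<pp>})"

definition is_complement :: "bsa_formula \<Rightarrow> bsa_formula \<Rightarrow> bsa_formula \<Rightarrow> bool" where
  "is_complement Z X Y \<longleftrightarrow> nvars Z = nvars X \<and> locus Z = locus X - locus Y"

definition var_prod :: "bsa_formula \<Rightarrow> bsa_formula \<Rightarrow> bsa_formula" where
  "var_prod X Y = join id X (\<lambda>j. nvars X + j) Y"

section \<open>The Grothendieck ring of real algebraic varieties\<close>

text \<open>The free abelian group on constructible varieties, with the bilinear product extending
  \<^const>\<open>var_prod\<close>.\<close>

definition var_free :: "(bsa_formula \<Rightarrow>\<^sub>0 int) ring" where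
  "var_free =
     \<lparr>carrier = {x. Poly_Mapping.keys x \<subseteq> constructible_varieties},
      mult = (\<lambda>x y. frag_extend (\<lambda>X. frag_extend (\<lambda>Y. frag_of (var_prod X Y)) y) x),
      one = frag_of empty_formula, zero = 0, add = (+)\<rparr>"

definition var_relations :: "(bsa_formula \<Rightarrow>\<^sub>0 int) set" where
  "var_relations =
     {frag_of X - frag_of Y | X Y.
        X \<in> constructible_varieties \<and> Y \<in> constructible_varieties \<and> iso_over_real X Y} \<union>
     {frag_of X - (frag_of Y + frag_of Z) | X Y Z.
        X \<in> constructible_varieties \<and> Y \<in> constructible_varieties \<and> Z \<in> constructible_varieties \<and>
        closed_subvariety Y X \<and> is_complement Z X Y}"

text \<open>Only the additive subgroup generated by the relations is factored out.\<close>

definition var_subgroup :: "(bsa_formula \<Rightarrow>\<^sub>0 int) set" where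
  "var_subgroup = generate (add_monoid var_free) var_relations"

definition K0_Var :: "(bsa_formula \<Rightarrow>\<^sub>0 int) set ring" where
  "K0_Var = var_free Quot var_subgroup"

definition var_class :: "bsa_formula \<Rightarrow> (bsa_formula \<Rightarrow>\<^sub>0 int) set" where
  "var_class X = var_subgroup +>\<^bsub>var_free\<^esub> frag_of X"

section \<open>The Grothendieck ring of basic semialgebraic formulas\<close>

definition bsa_free :: "(bsa_formula multiset \<Rightarrow>\<^sub>0 int) ring" where
  "bsa_free = mpoly_ring bsa_formulas"

definition bsa_symbol :: "bsa_formula \<Rightarrow> bsa_formula multiset \<Rightarrow>\<^sub>0 int" where
  "bsa_symbol A = Poly_Mapping.single {#A#} 1"

text \<open>
  Formulas are identified up to isomorphism only if they contain no inequality. In the product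
  relation the variables of the two formulas may be interleaved; a formula in \<open>n\<close> of the variables
  is a formula in \<open>X\<^sub>0, \<dots>, X\<^sub>n\<^sub>-\<^sub>1\<close> by the order-preserving renumbering. The last relation is the
  product relation for the empty family of formulas. It does not follow from the others: these only
  make the class of the empty formula act as the identity on all classes of formulas.
\<close>

definition bsa_relations :: "(bsa_formula multiset \<Rightarrow>\<^sub>0 int) set" where
  "bsa_relations =
     {bsa_symbol A - bsa_symbol B | A B.
        A \<in> bsa_formulas \<and> B \<in> bsa_formulas \<and> pos A = {} \<and> pos B = {} \<and> iso_over_real A B} \<union>
     {bsa_symbol A - (bsa_symbol (with_eq A S) + bsa_symbol (with_ineq A S)) | A S.
        A \<in> bsa_formulas \<and> S \<in> carrier (rpoly_ring (nvars A))} \<union>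
     {bsa_symbol (with_ineq A R) - (bsa_symbol (with_pos A R) + bsa_symbol (with_pos A (- R))) | A R.
        A \<in> bsa_formulas \<and> R \<in> carrier (rpoly_ring (nvars A))} \<union>
     {bsa_symbol (join \<sigma> A \<tau> B) - bsa_symbol A * bsa_symbol B | \<sigma> A \<tau> B.
        A \<in> bsa_formulas \<and> B \<in> bsa_formulas \<and>
        strict_mono_on {..<nvars A} \<sigma> \<and> strict_mono_on {..<nvars B} \<tau> \<and>
        \<sigma> ` {..<nvars A} \<inter> \<tau> ` {..<nvars B} = {} \<and>
        \<sigma> ` {..<nvars A} \<union> \<tau> ` {..<nvars B} = {..<nvars A + nvars B}} \<union>
     {bsa_symbol empty_formula - 1}"

definition bsa_ideal :: "(bsa_formula multiset \<Rightarrow>\<^sub>0 int) set" where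
  "bsa_ideal = Idl\<^bsub>bsa_free\<^esub> bsa_relations"

definition K0_BSA :: "(bsa_formula multiset \<Rightarrow>\<^sub>0 int) set ring" where
  "K0_BSA = bsa_free Quot bsa_ideal"

definition bsa_class :: "bsa_formula \<Rightarrow> (bsa_formula multiset \<Rightarrow>\<^sub>0 int) set" where
  "bsa_class A = bsa_ideal +>\<^bsub>bsa_free\<^esub> bsa_symbol A"

section \<open>The natural map\<close>

text \<open>The additive extension of \<open>X \<mapsto> [X]\<close>, evaluated on the representatives of a coset; all of them
  have the same value, so that \<^const>\<open>the_elem\<close> picks it.\<close>

definition natural_map ::
  "(bsa_formula \<Rightarrow>\<^sub>0 int) set \<Rightarrow> (bsa_formula multiset \<Rightarrow>\<^sub>0 int) set" where
  "natural_map c = the_elem ((\<lambda>x. bsa_ideal +>\<^bsub>bsa_free\<^esub> frag_extend bsa_symbol x) ` c)"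

end

theory Submission
  imports Defs "HOL-Library.Multiset_Order"
begin

text \<open>
  The natural map is well defined because the relations of varieties hold for formulas. Isomorphic
  varieties have equal symbols by definition. If \<open>Y\<close> is closed in \<open>X\<close>, cut out by a finite set \<open>S\<close> of
  polynomials, with complement \<open>Z\<close>, then splitting \<open>X\<close> and \<open>Z\<close> successively by the elements of \<open>S\<close>
  gives pieces with the same loci (\<open>bsa_ideal_scissor\<close>), and a variety is determined up to isomorphism by its
  locus (\<open>same_locus_iso\<close>). The latter is a form of the Nullstellensatz: a radical ideal is the intersection of
  the prime ideals above it, and an element that lies in none of them is a unit.

  Injectivity comes from a left inverse, which has to deal with inequalities without any division by
  two. Formulas with inequalities are identified only through the three families of relations for
  splitting, signs and products, never through isomorphisms. One can therefore pretend that every nonzero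
  polynomial \<open>R\<close> has a constant sign, that of its leading coefficient: if this is positive, then
  \<open>R > 0\<close> is replaced by \<open>R \<noteq> 0\<close>, and otherwise, as well as for \<open>R = 0\<close>, the formula is sent to zero.
  Then \<open>[A, R \<noteq> 0] = [A, R > 0] + [A, - R > 0]\<close> holds because one of the two terms is zero and the other
  equals the left-hand side. The product relation interleaves the variables of its two factors; it is respected
  because the monomial order in use, the multiset order, is preserved by strictly increasing renumberings
  of the variables (\<open>lead_coeff_pos_rename\<close>). On inequality-free formulas nothing is changed
  (\<open>sign_value_CV\<close>), so this is indeed a left inverse (\<open>retract_symbol_extend\<close>).

  For the left inverse to kill the whole ideal of relations, the additive relations of varieties
  must already form an ideal (\<open>var_subgroup_mult_right\<close>). The main point is that a product with a fixed
  variety preserves isomorphisms (\<open>var_prod_iso\<close>). Isomorphisms of coordinate rings are therefore expressed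
  as pairs of polynomial substitutions (\<open>morphism\<close>, \<open>iso_over_realI\<close>, \<open>iso_over_realE\<close>), which extend to
  products.
\<close>

section \<open>Polynomials and substitutions\<close>

lemma mpoly_ring_simps [simp]:
  "mult (mpoly_ring V) = (*)" "one (mpoly_ring V) = 1"
  "zero (mpoly_ring V) = 0" "add (mpoly_ring V) = (+)"
  by (simp_all add: mpoly_ring_def)

lemma mpoly_ring_carrier_iff:
  "p \<in> carrier (mpoly_ring V) \<longleftrightarrow> (\<forall>m \<in> Poly_Mapping.keys p. set_mset m \<subseteq> V)"
  by (simp add: mpoly_ring_def)

lemma mpoly_carrier_zero [simp]: "0 \<in> carrier (mpoly_ring V)"
  and mpoly_carrier_one [simp]: "1 \<in> carrier (mpoly_ring V)"
  by (auto simp: mpoly_ring_carrier_iff)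

lemma mpoly_carrier_single:
  "set_mset m \<subseteq> V \<Longrightarrow> Poly_Mapping.single m c \<in> carrier (mpoly_ring V)"
  by (auto simp: mpoly_ring_carrier_iff)

lemma mpoly_carrier_add [simp]:
  "p \<in> carrier (mpoly_ring V) \<Longrightarrow> q \<in> carrier (mpoly_ring V) \<Longrightarrow> p + q \<in> carrier (mpoly_ring V)"
  using keys_add[of p q] unfolding mpoly_ring_carrier_iff by blast

lemma mpoly_carrier_uminus [simp]:
  "p \<in> carrier (mpoly_ring V) \<Longrightarrow> - p \<in> carrier (mpoly_ring V)"
  unfolding mpoly_ring_carrier_iff by (simp add: in_keys_iff)

lemma mpoly_carrier_diff [simp]:
  "p \<in> carrier (mpoly_ring V) \<Longrightarrow> q \<in> carrier (mpoly_ring V) \<Longrightarrow> p - q \<in> carrier (mpoly_ring V)"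
  using mpoly_carrier_add[of p V "- q"] by simp

lemma mpoly_carrier_mult [simp]:
  assumes "p \<in> carrier (mpoly_ring V)" "q \<in> carrier (mpoly_ring V)"
  shows "p * q \<in> carrier (mpoly_ring V)"
  unfolding mpoly_ring_carrier_iff
proof
  fix m assume "m \<in> Poly_Mapping.keys (p * q)"
  then obtain a b where "a \<in> Poly_Mapping.keys p" "b \<in> Poly_Mapping.keys q" "m = a + b"
    using keys_mult[of p q] by blast
  then show "set_mset m \<subseteq> V" using assms by (auto simp: mpoly_ring_carrier_iff)
qed

lemma mpoly_carrier_power [simp]: "p \<in> carrier (mpoly_ring V) \<Longrightarrow> p ^ k \<in> carrier (mpoly_ring V)"
  by (induction k) simp_all

lemma mpoly_carrier_prod:
  "(\<And>q. q \<in> Q \<Longrightarrow> f q \<in> carrier (mpoly_ring V)) \<Longrightarrow> prod f Q \<in> carrier (mpoly_ring V)"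
  by (induction Q rule: infinite_finite_induct) auto

lemma mpoly_carrier_mono: "V \<subseteq> W \<Longrightarrow> carrier (mpoly_ring V) \<subseteq> carrier (mpoly_ring W)"
  by (rule subsetI) (auto simp: mpoly_ring_carrier_iff subset_iff)

lemma mpoly_ring_cring: "cring (mpoly_ring V)"
proof (rule cringI)
  show "abelian_group (mpoly_ring V)"
  proof (rule abelian_groupI, goal_cases)
    case (6 x)
    then show ?case by (intro bexI[of _ "- x"]) simp_all
  qed (simp_all add: add.assoc add.commute)
  show "Group.comm_monoid (mpoly_ring V)"
    by (rule comm_monoidI) (simp_all add: mult.assoc mult.commute)
qed (simp add: distrib_right)

lemma mpoly_ring_a_inv:
  assumes "x \<in> carrier (mpoly_ring V)" shows "\<ominus>\<^bsub>mpoly_ring V\<^esub> x = - x"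
proof -
  interpret cring "mpoly_ring V" by (rule mpoly_ring_cring)
  show ?thesis using assms minus_equality[of "- x" x] by simp
qed

lemma mpoly_ring_a_minus:
  assumes "x \<in> carrier (mpoly_ring V)" "y \<in> carrier (mpoly_ring V)"
  shows "x \<ominus>\<^bsub>mpoly_ring V\<^esub> y = x - y"
  using assms by (simp add: a_minus_def mpoly_ring_a_inv)

lemma mpoly_ring_nat_pow: "x [^]\<^bsub>mpoly_ring V\<^esub> (k::nat) = x ^ k"
proof -
  interpret cring "mpoly_ring V" by (rule mpoly_ring_cring)
  show ?thesis
    by (induction k) (simp_all add: nat_pow_def mult.commute)
qed

lemma sum_singles_keys:
  "(\<Sum>m \<in> Poly_Mapping.keys p. Poly_Mapping.single m (Poly_Mapping.lookup p m)) = p"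
  by (rule poly_mapping_eqI)
    (auto simp: lookup_sum lookup_single when_def in_keys_iff)

lemma mpoly_single_sum_induct:
  assumes single: "\<And>m c. set_mset m \<subseteq> V \<Longrightarrow> P (Poly_Mapping.single m c)"
    and add: "\<And>p q. P p \<Longrightarrow> P q \<Longrightarrow> P (p + q)"
    and p: "p \<in> carrier (mpoly_ring V)"
  shows "P p"
proof -
  have zero: "P 0" using single[of "{#}" 0] by simp
  have "P (\<Sum>m \<in> K. Poly_Mapping.single m (Poly_Mapping.lookup p m))"
    if "finite K" "K \<subseteq> Poly_Mapping.keys p" for K
    using that
  proof (induction K rule: finite_induct)
    case (insert m K)
    then have "set_mset m \<subseteq> V" using p by (auto simp: mpoly_ring_carrier_iff)
    with insert show ?case by (simp add: add single)
  qed (simp add: zero)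
  from this[of "Poly_Mapping.keys p"] show ?thesis by (simp add: sum_singles_keys)
qed

lemma mpoly_induct [consumes 1, case_names const var add mult]:
  assumes p: "p \<in> carrier (mpoly_ring V)"
    and const: "\<And>c. P (Poly_Mapping.single {#} c)"
    and var: "\<And>v. v \<in> V \<Longrightarrow> P (Poly_Mapping.single {#v#} 1)"
    and add: "\<And>p q. \<lbrakk>p \<in> carrier (mpoly_ring V); q \<in> carrier (mpoly_ring V); P p; P q\<rbrakk> \<Longrightarrow> P (p + q)"
    and mult: "\<And>p q. \<lbrakk>p \<in> carrier (mpoly_ring V); q \<in> carrier (mpoly_ring V); P p; P q\<rbrakk> \<Longrightarrow> P (p * q)"
  shows "P p"
proof -
  have single: "P (Poly_Mapping.single m c)" if "set_mset m \<subseteq> V" for m c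
    using that
  proof (induction m)
    case empty
    then show ?case by (simp add: const)
  next
    case (add v m)
    have "Poly_Mapping.single (add_mset v m) c = Poly_Mapping.single {#v#} 1 * Poly_Mapping.single m c"
      by (simp add: mult_single)
    with add show ?case by (auto intro!: mult var mpoly_carrier_single)
  qed
  have "p \<in> carrier (mpoly_ring V) \<and> P p"
    by (rule mpoly_single_sum_induct[OF _ _ p]) (auto simp: single add mpoly_carrier_single)
  then show ?thesis by simp
qed

section \<open>Real polynomials\<close>

abbreviation Rpoly :: "nat \<Rightarrow> rpoly set" where "Rpoly n \<equiv> carrier (rpoly_ring n)"

lemma rpoly_ring_simps [simp]:
  "mult (rpoly_ring n) = (*)" "one (rpoly_ring n) = 1"
  "zero (rpoly_ring n) = 0" "add (rpoly_ring n) = (+)"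
  by (simp_all add: rpoly_ring_def)

lemma Rpoly_closed [simp]:
  "0 \<in> Rpoly n" "1 \<in> Rpoly n"
  "p \<in> Rpoly n \<Longrightarrow> q \<in> Rpoly n \<Longrightarrow> p + q \<in> Rpoly n"
  "p \<in> Rpoly n \<Longrightarrow> q \<in> Rpoly n \<Longrightarrow> p - q \<in> Rpoly n"
  "p \<in> Rpoly n \<Longrightarrow> q \<in> Rpoly n \<Longrightarrow> p * q \<in> Rpoly n"
  "p \<in> Rpoly n \<Longrightarrow> - p \<in> Rpoly n"
  "p \<in> Rpoly n \<Longrightarrow> p ^ k \<in> Rpoly n"
  "i < n \<Longrightarrow> rvar i \<in> Rpoly n" "rconst c \<in> Rpoly n"
  by (auto simp: rpoly_ring_def rvar_def rconst_def intro!: mpoly_carrier_single)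

lemma Rpoly_prod: "(\<And>q. q \<in> Q \<Longrightarrow> f q \<in> Rpoly n) \<Longrightarrow> prod f Q \<in> Rpoly n"
  unfolding rpoly_ring_def by (rule mpoly_carrier_prod)

lemma Rpoly_mono: "n \<le> m \<Longrightarrow> Rpoly n \<subseteq> Rpoly m"
  unfolding rpoly_ring_def by (rule mpoly_carrier_mono) auto

lemma Rpoly_Suc: "p \<in> Rpoly n \<Longrightarrow> p \<in> Rpoly (Suc n)"
  using Rpoly_mono[of n "Suc n"] by auto

lemma rpoly_cring: "cring (rpoly_ring n)"
  unfolding rpoly_ring_def by (rule mpoly_ring_cring)

lemma rpoly_ring_ops:
  "x \<in> Rpoly n \<Longrightarrow> \<ominus>\<^bsub>rpoly_ring n\<^esub> x = - x"
  "x \<in> Rpoly n \<Longrightarrow> y \<in> Rpoly n \<Longrightarrow> x \<ominus>\<^bsub>rpoly_ring n\<^esub> y = x - y"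
  "x [^]\<^bsub>rpoly_ring n\<^esub> (k::nat) = x ^ k"
  unfolding rpoly_ring_def by (simp_all add: mpoly_ring_a_inv mpoly_ring_a_minus mpoly_ring_nat_pow)

lemma rpoly_induct [consumes 1, case_names const var add mult]:
  assumes "p \<in> Rpoly n"
    and "\<And>c. P (rconst c)"
    and "\<And>v. v < n \<Longrightarrow> P (rvar v)"
    and "\<And>p q. \<lbrakk>p \<in> Rpoly n; q \<in> Rpoly n; P p; P q\<rbrakk> \<Longrightarrow> P (p + q)"
    and "\<And>p q. \<lbrakk>p \<in> Rpoly n; q \<in> Rpoly n; P p; P q\<rbrakk> \<Longrightarrow> P (p * q)"
  shows "P p"
  using assms(1) unfolding rpoly_ring_def
  by (rule mpoly_induct) (use assms(2-) in \<open>auto simp: rconst_def rvar_def rpoly_ring_def\<close>)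

definition subst :: "(nat \<Rightarrow> rpoly) \<Rightarrow> rpoly \<Rightarrow> rpoly" where
  "subst f p =
     (\<Sum>m \<in> Poly_Mapping.keys p. rconst (Poly_Mapping.lookup p m) * prod_mset (image_mset f m))"

lemma rconst_simps [simp]:
  "rconst 0 = 0" "rconst 1 = 1"
  "rconst (a + b) = rconst a + rconst b" "rconst (a * b) = rconst a * rconst b"
  by (simp_all add: rconst_def single_add mult_single)

lemma subst_single: "subst f (Poly_Mapping.single m c) = rconst c * prod_mset (image_mset f m)"
  by (simp add: subst_def)

lemma subst_zero [simp]: "subst f 0 = 0"
  by (simp add: subst_def)

lemma subst_add [simp]: "subst f (p + q) = subst f p + subst f q"
  unfolding subst_def
  by (rule setsum_keys_plus_distrib) (simp_all add: distrib_right)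

lemma subst_rconst [simp]: "subst f (rconst c) = rconst c"
  unfolding rconst_def[of c] by (subst subst_single) (simp add: rconst_def)

lemma subst_one [simp]: "subst f 1 = 1"
  using subst_rconst[of f 1] by simp

lemma subst_rvar [simp]: "subst f (rvar i) = f i"
  by (simp add: rvar_def subst_single)

lemma subst_uminus [simp]: "subst f (- p) = - subst f p"
  using subst_add[of f p "- p"] by (simp add: eq_neg_iff_add_eq_0 add.commute)

lemma subst_diff [simp]: "subst f (p - q) = subst f p - subst f q"
  using subst_add[of f p "- q"] by simp

lemma rpoly_UNIV: "(p :: rpoly) \<in> carrier (mpoly_ring UNIV)"
  by (simp add: mpoly_ring_carrier_iff)

lemma subst_mult [simp]: "subst f (p * q) = subst f p * subst f q"
proof (rule mpoly_single_sum_induct[OF _ _ rpoly_UNIV[of p]])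
  fix m c
  show "subst f (Poly_Mapping.single m c * q) = subst f (Poly_Mapping.single m c) * subst f q"
  proof (rule mpoly_single_sum_induct[OF _ _ rpoly_UNIV[of q]])
    fix m' c'
    show "subst f (Poly_Mapping.single m c * Poly_Mapping.single m' c') =
        subst f (Poly_Mapping.single m c) * subst f (Poly_Mapping.single m' c')"
      by (simp add: mult_single subst_single ac_simps)
  qed (simp add: algebra_simps)
qed (simp add: algebra_simps)

lemma subst_power [simp]: "subst f (p ^ k) = subst f p ^ k"
  by (induction k) simp_all

lemma subst_prod: "subst f (prod g Q) = (\<Prod>q \<in> Q. subst f (g q))"
  by (induction Q rule: infinite_finite_induct) simp_all

lemma subst_closed:
  assumes "p \<in> Rpoly n" "\<And>i. i < n \<Longrightarrow> f i \<in> Rpoly m"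
  shows "subst f p \<in> Rpoly m"
  using assms(1) by (induction rule: rpoly_induct) (simp_all add: assms(2))

lemma subst_cong:
  assumes "p \<in> Rpoly n" "\<And>i. i < n \<Longrightarrow> f i = g i"
  shows "subst f p = subst g p"
  using assms(1) by (induction rule: rpoly_induct) (simp_all add: assms(2))

lemma subst_subst: "subst f (subst g p) = subst (\<lambda>i. subst f (g i)) p"
proof (rule mpoly_induct[OF rpoly_UNIV[of p]])
qed (simp_all add: rconst_def[symmetric] rvar_def[symmetric])

lemma subst_rvar_id [simp]: "subst rvar p = p"
proof (rule mpoly_induct[OF rpoly_UNIV[of p]])
qed (simp_all add: rconst_def[symmetric] rvar_def[symmetric])

lemma rename_eq_subst: "rename \<sigma> p = subst (\<lambda>i. rvar (\<sigma> i)) p"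
proof -
  have "prod_mset (image_mset (\<lambda>i. rvar (\<sigma> i)) m) = Poly_Mapping.single (image_mset \<sigma> m) 1" for m
    by (induction m) (simp_all add: rvar_def mult_single)
  then show ?thesis
    by (simp add: rename_def subst_def rconst_def mult_single)
qed

lemma rename_closed:
  "p \<in> Rpoly n \<Longrightarrow> (\<And>i. i < n \<Longrightarrow> \<sigma> i < m) \<Longrightarrow> rename \<sigma> p \<in> Rpoly m"
  unfolding rename_eq_subst by (rule subst_closed) auto

lemma rename_rename: "rename \<sigma> (rename \<tau> p) = rename (\<sigma> \<circ> \<tau>) p"
  by (simp add: rename_eq_subst subst_subst)

lemma rename_id [simp]: "rename id p = p"
  by (simp add: rename_eq_subst)

section \<open>The sign of the leading coefficient\<close>

text \<open>Monomials are compared in the multiset extension of the order of the indices: every strictly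
  increasing renumbering of the variables is then increasing on monomials, and preserves the leading
  coefficient.\<close>

definition lead_coeff_pos :: "rpoly \<Rightarrow> bool" where
  "lead_coeff_pos p \<longleftrightarrow> p \<noteq> 0 \<and> Poly_Mapping.lookup p (Max (Poly_Mapping.keys p)) > 0"

lemma not_lead_coeff_pos_0 [simp]: "\<not> lead_coeff_pos 0"
  by (simp add: lead_coeff_pos_def)

lemma lead_coeff_pos_uminus:
  assumes "p \<noteq> 0" shows "lead_coeff_pos (- p) \<longleftrightarrow> \<not> lead_coeff_pos p"
proof -
  have keys: "Poly_Mapping.keys (- p) = Poly_Mapping.keys p" by (auto simp: in_keys_iff)
  have "Poly_Mapping.keys p \<noteq> {}" using assms sum_singles_keys[of p] by auto
  then have "Max (Poly_Mapping.keys p) \<in> Poly_Mapping.keys p" by simp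
  then have "Poly_Mapping.lookup p (Max (Poly_Mapping.keys p)) \<noteq> 0" by (simp add: in_keys_iff)
  then show ?thesis using assms unfolding lead_coeff_pos_def keys by auto
qed

lemma lookup_rename:
  assumes inj: "inj_on \<sigma> {..<n}" and p: "p \<in> Rpoly n" and m: "set_mset m \<subseteq> {..<n}"
  shows "Poly_Mapping.lookup (rename \<sigma> p) (image_mset \<sigma> m) = Poly_Mapping.lookup p m"
proof -
  have "image_mset \<sigma> m' = image_mset \<sigma> m \<longleftrightarrow> m' = m" if "m' \<in> Poly_Mapping.keys p" for m'
  proof
    have m': "set_mset m' \<subseteq> {..<n}"
      using p that by (simp add: rpoly_ring_def mpoly_ring_carrier_iff)
    assume *: "image_mset \<sigma> m' = image_mset \<sigma> m"
    have "image_mset (inv_into {..<n} \<sigma> \<circ> \<sigma>) k = k" if "set_mset k \<subseteq> {..<n}" for k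
      using that inj by (induction k) auto
    from this[OF m] this[OF m'] * show "m' = m"
      by (simp flip: multiset.map_comp)
  qed simp
  then have "Poly_Mapping.lookup (rename \<sigma> p) (image_mset \<sigma> m) =
      (\<Sum>m' \<in> Poly_Mapping.keys p. if m' = m then Poly_Mapping.lookup p m' else 0)"
    unfolding rename_def lookup_sum lookup_single when_def by (intro sum.cong) simp_all
  then show ?thesis by (auto simp: in_keys_iff)
qed

lemma keys_rename:
  assumes inj: "inj_on \<sigma> {..<n}" and p: "p \<in> Rpoly n"
  shows "Poly_Mapping.keys (rename \<sigma> p) = image_mset \<sigma> ` Poly_Mapping.keys p"
proof (intro equalityI subsetI)
  fix k assume "k \<in> Poly_Mapping.keys (rename \<sigma> p)"
  then show "k \<in> image_mset \<sigma> ` Poly_Mapping.keys p"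
    unfolding rename_def using keys_sum[of _ "Poly_Mapping.keys p"]
    by (auto simp: in_keys_iff lookup_sum lookup_single when_def elim!: sum.not_neutral_contains_not_neutral
        split: if_splits)
next
  fix k assume "k \<in> image_mset \<sigma> ` Poly_Mapping.keys p"
  then obtain m where m: "k = image_mset \<sigma> m" "m \<in> Poly_Mapping.keys p" by auto
  with p have "set_mset m \<subseteq> {..<n}" by (simp add: rpoly_ring_def mpoly_ring_carrier_iff)
  with m show "k \<in> Poly_Mapping.keys (rename \<sigma> p)"
    using lookup_rename[OF inj p] by (simp add: in_keys_iff)
qed

lemma lead_coeff_pos_rename:
  assumes mono: "strict_mono_on {..<n} \<sigma>" and p: "p \<in> Rpoly n"
  shows "lead_coeff_pos (rename \<sigma> p) \<longleftrightarrow> lead_coeff_pos p"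
proof (cases "p = 0")
  case True
  then show ?thesis by (simp add: rename_def)
next
  case False
  have inj: "inj_on \<sigma> {..<n}" by (rule strict_mono_on_imp_inj_on[OF mono])
  let ?K = "Poly_Mapping.keys p"
  have ne: "?K \<noteq> {}" using False sum_singles_keys[of p] by auto
  have sub: "set_mset m \<subseteq> {..<n}" if "m \<in> ?K" for m
    using p that by (simp add: rpoly_ring_def mpoly_ring_carrier_iff)
  have max: "Max ?K \<in> ?K" using ne by simp
  have "Max (Poly_Mapping.keys (rename \<sigma> p)) = image_mset \<sigma> (Max ?K)"
    unfolding keys_rename[OF inj p]
  proof (rule Max_eqI)
    fix k assume "k \<in> image_mset \<sigma> ` ?K"
    then obtain m where m: "k = image_mset \<sigma> m" "m \<in> ?K" by auto
    then have "m \<le> Max ?K" by simp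
    then show "k \<le> image_mset \<sigma> (Max ?K)"
      unfolding m(1)
      using sub[OF m(2)] sub[OF max] strict_mono_onD[OF mono]
      by (intro image_mset_mono) (auto simp: subset_iff)
  qed (use max in auto)
  moreover have "rename \<sigma> p \<noteq> 0"
    using keys_rename[OF inj p] ne by auto
  ultimately show ?thesis
    using False lookup_rename[OF inj p sub[OF max]] by (simp add: lead_coeff_pos_def)
qed

section \<open>Ideals of polynomial rings\<close>

lemma mpoly_ideal_iff:
  "ideal I (mpoly_ring V) \<longleftrightarrow> I \<subseteq> carrier (mpoly_ring V) \<and> 0 \<in> I \<and>
     (\<forall>a \<in> I. \<forall>b \<in> I. a + b \<in> I) \<and> (\<forall>a \<in> I. \<forall>x \<in> carrier (mpoly_ring V). x * a \<in> I)"
  (is "?L \<longleftrightarrow> ?R")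
proof
  assume ?L
  then interpret ideal I "mpoly_ring V" .
  show ?R
    using a_subset additive_subgroup.a_closed[OF additive_subgroup_axioms] I_l_closed
      additive_subgroup.zero_closed[OF additive_subgroup_axioms] by auto
next
  assume R: ?R
  interpret cring "mpoly_ring V" by (rule mpoly_ring_cring)
  have neg: "- a \<in> I" if "a \<in> I" for a
  proof -
    have "(- 1) * a \<in> I" using R that by (intro R[THEN conjunct2, THEN conjunct2, THEN conjunct2, rule_format]) auto
    then show ?thesis by simp
  qed
  show ?L
  proof (rule idealI)
    show "subgroup I (add_monoid (mpoly_ring V))"
    proof (rule add.subgroupI)
      show "I \<noteq> {}" using R by auto
      show "\<ominus>\<^bsub>mpoly_ring V\<^esub> a \<in> I" if "a \<in> I" for a
        using R that neg by (subst mpoly_ring_a_inv) auto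
    qed (use R in auto)
    show "x \<otimes>\<^bsub>mpoly_ring V\<^esub> a \<in> I" "a \<otimes>\<^bsub>mpoly_ring V\<^esub> x \<in> I"
      if "a \<in> I" "x \<in> carrier (mpoly_ring V)" for a x
      using R that by (auto simp: mult.commute)
  qed (rule ring_axioms)
qed

lemma mpoly_primeideal_iff:
  "primeideal P (mpoly_ring V) \<longleftrightarrow> ideal P (mpoly_ring V) \<and> 1 \<notin> P \<and>
     (\<forall>a \<in> carrier (mpoly_ring V). \<forall>b \<in> carrier (mpoly_ring V). a * b \<in> P \<longrightarrow> a \<in> P \<or> b \<in> P)"
  (is "?L \<longleftrightarrow> ?R")
proof
  assume ?L
  then interpret primeideal P "mpoly_ring V" .
  show ?R using ideal_axioms I_prime one_imp_carrier I_notcarr by auto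
next
  assume R: ?R
  show ?L
    by (rule primeidealI) (use R mpoly_ring_cring in auto)
qed

text \<open>An ideal maximal among those containing no power of \<open>f\<close> is prime.\<close>

lemma prime_ideal_avoiding:
  fixes f :: "'v multiset \<Rightarrow>\<^sub>0 'k::comm_ring_1"
  assumes J: "ideal J (mpoly_ring V)" and f: "f \<in> carrier (mpoly_ring V)"
    and pow: "\<And>k. f ^ k \<notin> J"
  obtains P where "primeideal P (mpoly_ring V)" "J \<subseteq> P" "f \<notin> P"
proof -
  let ?R = "carrier (mpoly_ring V) :: ('v multiset \<Rightarrow>\<^sub>0 'k) set"
  define \<A> where "\<A> = {I. ideal I (mpoly_ring V) \<and> J \<subseteq> I \<and> (\<forall>k. f ^ k \<notin> I)}"
  have "\<exists>M \<in> \<A>. \<forall>X \<in> \<A>. M \<subseteq> X \<longrightarrow> X = M"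
  proof (rule subset_Zorn_nonempty)
    show "\<A> \<noteq> {}" using J pow by (auto simp: \<A>_def)
    fix \<C> assume ne: "\<C> \<noteq> {}" and chain: "subset.chain \<A> \<C>"
    have ide: "I \<subseteq> ?R" "0 \<in> I" "\<And>a b. a \<in> I \<Longrightarrow> b \<in> I \<Longrightarrow> a + b \<in> I"
      "\<And>a x. a \<in> I \<Longrightarrow> x \<in> ?R \<Longrightarrow> x * a \<in> I" "J \<subseteq> I" "\<And>k. f ^ k \<notin> I"
      if "I \<in> \<C>" for I
    proof -
      have "I \<in> \<A>" using chain that by (auto simp: subset.chain_def)
      then show "I \<subseteq> ?R" "0 \<in> I" "\<And>a b. a \<in> I \<Longrightarrow> b \<in> I \<Longrightarrow> a + b \<in> I"
        "\<And>a x. a \<in> I \<Longrightarrow> x \<in> ?R \<Longrightarrow> x * a \<in> I" "J \<subseteq> I" "\<And>k. f ^ k \<notin> I"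
        by (auto simp: \<A>_def mpoly_ideal_iff)
    qed
    have "a + b \<in> \<Union>\<C>" if "a \<in> \<Union>\<C>" "b \<in> \<Union>\<C>" for a b
    proof -
      obtain A B where AB: "A \<in> \<C>" "B \<in> \<C>" "a \<in> A" "b \<in> B"
        using \<open>a \<in> \<Union>\<C>\<close> \<open>b \<in> \<Union>\<C>\<close> by blast
      then have "A \<subseteq> B \<or> B \<subseteq> A" using chain by (auto simp: subset.chain_def)
      then show ?thesis
      proof
        assume "A \<subseteq> B" then show ?thesis using AB ide(3)[of B a b] by auto
      next
        assume "B \<subseteq> A" then show ?thesis using AB ide(3)[of A a b] by auto
      qed
    qed
    moreover have "\<Union>\<C> \<subseteq> ?R" "0 \<in> \<Union>\<C>" using ne ide(1,2) by blast+
    moreover have "x * a \<in> \<Union>\<C>" if "a \<in> \<Union>\<C>" "x \<in> ?R" for a x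
      using that ide(4) by blast
    ultimately have "ideal (\<Union>\<C>) (mpoly_ring V)"
      unfolding mpoly_ideal_iff by simp
    moreover have "J \<subseteq> \<Union>\<C>" using ne ide(5) by blast
    ultimately show "\<Union>\<C> \<in> \<A>" using ide(6) by (auto simp: \<A>_def)
  qed
  then obtain P where PA: "P \<in> \<A>" and max: "\<And>I. I \<in> \<A> \<Longrightarrow> P \<subseteq> I \<Longrightarrow> I = P" by blast
  have P: "P \<subseteq> ?R" "0 \<in> P" "\<And>a b. a \<in> P \<Longrightarrow> b \<in> P \<Longrightarrow> a + b \<in> P"
      "\<And>a x. a \<in> P \<Longrightarrow> x \<in> ?R \<Longrightarrow> x * a \<in> P" "J \<subseteq> P" "\<And>k. f ^ k \<notin> P"
    using PA by (auto simp: \<A>_def mpoly_ideal_iff)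
  have power_in: "\<exists>k p x. p \<in> P \<and> x \<in> ?R \<and> f ^ k = p + x * a" if a: "a \<in> ?R" "a \<notin> P" for a
  proof (rule ccontr)
    assume none: "\<not> ?thesis"
    define I where "I = {p + x * a | p x. p \<in> P \<and> x \<in> ?R}"
    have "ideal I (mpoly_ring V)"
      unfolding mpoly_ideal_iff
    proof (intro conjI ballI)
      show "I \<subseteq> ?R" using P(1) a(1) by (auto simp: I_def)
      have "0 = 0 + 0 * a \<and> 0 \<in> P \<and> 0 \<in> ?R" using P(2) by simp
      then show "0 \<in> I" unfolding I_def by blast
      fix u assume "u \<in> I"
      then obtain p x where u: "u = p + x * a" "p \<in> P" "x \<in> ?R" by (auto simp: I_def)
      { fix v assume "v \<in> I"
        then obtain p' x' where v: "v = p' + x' * a" "p' \<in> P" "x' \<in> ?R" by (auto simp: I_def)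
        have "u + v = (p + p') + (x + x') * a" using u v by (simp add: algebra_simps)
        then show "u + v \<in> I" 
          unfolding I_def mem_Collect_eq using P(3)[OF u(2) v(2)] mpoly_carrier_add[OF u(3) v(3)] by metis }
      { fix y assume y: "y \<in> ?R"
        have "y * u = y * p + (y * x) * a" using u by (simp add: algebra_simps)
        then show "y * u \<in> I" 
          unfolding I_def mem_Collect_eq using P(4)[OF u(2) y] mpoly_carrier_mult[OF y u(3)] by metis }
    qed
    moreover have PI: "P \<subseteq> I"
    proof
      fix p assume "p \<in> P"
      then have "p = p + 0 * a \<and> p \<in> P \<and> 0 \<in> ?R" by simp
      then show "p \<in> I" unfolding I_def by blast
    qed
    ultimately have "I \<in> \<A>" using none P(5) by (auto simp: \<A>_def I_def)
    then have "I = P" using max PI by simp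
    moreover have "a = 0 + 1 * a \<and> 0 \<in> P \<and> 1 \<in> ?R" using P(2) by simp
    then have "a \<in> I" unfolding I_def by blast
    ultimately show False using a(2) by simp
  qed
  have "primeideal P (mpoly_ring V)"
    unfolding mpoly_primeideal_iff
  proof (intro conjI ballI impI)
    show "ideal P (mpoly_ring V)" using PA by (simp add: \<A>_def)
    show "1 \<notin> P" using P(6)[of 0] by simp
    fix a b assume ab: "a \<in> ?R" "b \<in> ?R" "a * b \<in> P"
    show "a \<in> P \<or> b \<in> P"
    proof (rule ccontr)
      assume "\<not> ?thesis"
      then obtain k p x l q y where
        k: "p \<in> P" "x \<in> ?R" "f ^ k = p + x * a" and l: "q \<in> P" "y \<in> ?R" "f ^ l = q + y * b"
        using power_in[OF ab(1)] power_in[OF ab(2)] by metis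
      have "f ^ (k + l) = (q + y * b) * p + ((x * a) * q + (x * y) * (a * b))"
        unfolding power_add k(3) l(3) by (simp add: algebra_simps)
      also have "\<dots> \<in> P"
        using P(3,4) k l ab subsetD[OF P(1) l(1)] by simp
      finally show False using P(6) by simp
    qed
  qed
  moreover have "f \<notin> P" using P(6)[of 1] by simp
  ultimately show thesis using that P(5) by blast
qed

lemma rpoly_ideal_closed:
  assumes "ideal I (rpoly_ring n)"
  shows "I \<subseteq> Rpoly n" "0 \<in> I" "\<And>a b. a \<in> I \<Longrightarrow> b \<in> I \<Longrightarrow> a + b \<in> I"
    "\<And>a b. a \<in> I \<Longrightarrow> b \<in> I \<Longrightarrow> a - b \<in> I"
    "\<And>a x. a \<in> I \<Longrightarrow> x \<in> Rpoly n \<Longrightarrow> x * a \<in> I"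
    "\<And>a x. a \<in> I \<Longrightarrow> x \<in> Rpoly n \<Longrightarrow> a * x \<in> I"
proof -
  show *: "I \<subseteq> Rpoly n" "0 \<in> I" "\<And>a b. a \<in> I \<Longrightarrow> b \<in> I \<Longrightarrow> a + b \<in> I"
    "\<And>a x. a \<in> I \<Longrightarrow> x \<in> Rpoly n \<Longrightarrow> x * a \<in> I"
    using assms by (auto simp: rpoly_ring_def mpoly_ideal_iff)
  show "\<And>a x. a \<in> I \<Longrightarrow> x \<in> Rpoly n \<Longrightarrow> a * x \<in> I" using *(4) by (simp add: mult.commute)
  show "a - b \<in> I" if "a \<in> I" "b \<in> I" for a b
    using *(3)[OF that(1) *(4)[OF that(2), of "- 1"]] by simp
qed

text \<open>Each term of the binomial expansion of \<open>(a + b) ^ (k + l)\<close> contains \<open>a ^ k\<close> or \<open>b ^ l\<close>.\<close>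

lemma radical_ideal:
  assumes "ideal I (rpoly_ring n)"
  shows "ideal (radical (rpoly_ring n) I) (rpoly_ring n)"
proof -
  note I = rpoly_ideal_closed[OF assms]
  have pow: "a ^ m \<in> I" if "a ^ k \<in> I" "k \<le> m" "a \<in> Rpoly n" for a k m
    using I(5)[OF that(1), of "a ^ (m - k)"] that by (simp flip: power_add)
  have ofnat: "of_nat k \<in> Rpoly n" for k
    by (induction k) simp_all
  let ?J = "{f \<in> Rpoly n. \<exists>k. f ^ k \<in> I}"
  have J: "radical (rpoly_ring n) I = ?J"
    by (simp add: radical_def rpoly_ring_ops)
  have "a + b \<in> ?J" if "a \<in> ?J" "b \<in> ?J" for a b
  proof -
    obtain k l where k: "a ^ k \<in> I" and l: "b ^ l \<in> I" using \<open>a \<in> ?J\<close> \<open>b \<in> ?J\<close> by blast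
    have ab: "a \<in> Rpoly n" "b \<in> Rpoly n" using that by auto
    have summand: "of_nat (k + l choose i) * a ^ i * b ^ (k + l - i) \<in> I" for i
    proof (cases "k \<le> i")
      case True
      have "of_nat (k + l choose i) * b ^ (k + l - i) * a ^ i \<in> I"
        by (rule I(5)[OF pow[OF k True ab(1)]]) (simp add: ab ofnat)
      then show ?thesis by (simp add: ac_simps)
    next
      case False
      then have "l \<le> k + l - i" by simp
      from I(5)[OF pow[OF l this ab(2)], of "of_nat (k + l choose i) * a ^ i"]
      show ?thesis by (simp add: ab ofnat)
    qed
    have "(\<Sum>i \<in> A. of_nat (k + l choose i) * a ^ i * b ^ (k + l - i)) \<in> I" for A
      by (induction A rule: infinite_finite_induct) (auto simp: I(2) intro!: I(3) summand)
    then have "(a + b) ^ (k + l) \<in> I" by (simp add: binomial_ring)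
    then show ?thesis using ab by auto
  qed
  moreover have "x * a \<in> ?J" if "a \<in> ?J" "x \<in> Rpoly n" for a x
  proof -
    obtain k where "a ^ k \<in> I" using \<open>a \<in> ?J\<close> by blast
    then have "(x * a) ^ k \<in> I" using I(5) \<open>x \<in> Rpoly n\<close> by (simp add: power_mult_distrib)
    then show ?thesis using that by auto
  qed
  moreover have "0 \<in> ?J" using I(2) by (auto intro: exI[of _ 1])
  ultimately show ?thesis
    unfolding J unfolding rpoly_ring_def mpoly_ideal_iff by blast
qed

section \<open>Coordinate rings and morphisms\<close>

abbreviation "CV \<equiv> constructible_varieties"

lemma bsa_formulasD:
  assumes "A \<in> bsa_formulas"
  shows "eqs A \<subseteq> Rpoly (nvars A)" "ineqs A \<subseteq> Rpoly (nvars A)" "pos A \<subseteq> Rpoly (nvars A)"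
    "finite (eqs A)" "finite (ineqs A)" "finite (pos A)"
  using assms by (auto simp: bsa_formulas_def)

lemma CVD:
  assumes "X \<in> CV"
  shows "X \<in> bsa_formulas" "pos X = {}" "eqs X \<subseteq> Rpoly (nvars X)" "ineqs X \<subseteq> Rpoly (nvars X)"
    "finite (eqs X)" "finite (ineqs X)"
  using assms by (auto simp: constructible_varieties_def bsa_formulas_def)

definition coord_gens :: "bsa_formula \<Rightarrow> rpoly set" where
  "coord_gens X = eqs X \<union> {rvar (nvars X) * (\<Prod>q \<in> ineqs X. q) - 1}"

lemma coord_ideal_eq:
  "coord_ideal X =
     radical (rpoly_ring (Suc (nvars X))) (Idl\<^bsub>rpoly_ring (Suc (nvars X))\<^esub> (coord_gens X))"
  by (simp add: coord_ideal_def coord_gens_def Let_def)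

lemma coord_gens_closed: "X \<in> CV \<Longrightarrow> coord_gens X \<subseteq> Rpoly (Suc (nvars X))"
  using CVD[of X] unfolding coord_gens_def
  by (auto intro!: Rpoly_closed Rpoly_prod intro: Rpoly_Suc)

lemma Idl_coord_gens: "X \<in> CV \<Longrightarrow>
    ideal (Idl\<^bsub>rpoly_ring (Suc (nvars X))\<^esub> (coord_gens X)) (rpoly_ring (Suc (nvars X)))"
  by (rule ring.genideal_ideal[OF cring.axioms(1)[OF rpoly_cring] coord_gens_closed])

lemma coord_ideal_ideal: "X \<in> CV \<Longrightarrow> ideal (coord_ideal X) (rpoly_ring (Suc (nvars X)))"
  unfolding coord_ideal_eq by (intro radical_ideal Idl_coord_gens)

lemmas coord_ideal_closed = rpoly_ideal_closed[OF coord_ideal_ideal]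

lemma Idl_subset_coord_ideal:
  "X \<in> CV \<Longrightarrow> Idl\<^bsub>rpoly_ring (Suc (nvars X))\<^esub> (coord_gens X) \<subseteq> coord_ideal X"
  using rpoly_ideal_closed(1)[OF Idl_coord_gens]
  unfolding coord_ideal_eq radical_def rpoly_ring_ops
  by (auto intro: exI[of _ "1::nat"])

lemma coord_gens_in_ideal: "X \<in> CV \<Longrightarrow> coord_gens X \<subseteq> coord_ideal X"
  using ring.genideal_self[OF cring.axioms(1)[OF rpoly_cring] coord_gens_closed]
    Idl_subset_coord_ideal by blast

lemma coord_ideal_minimal:
  assumes "X \<in> CV" "ideal J (rpoly_ring (Suc (nvars X)))" "coord_gens X \<subseteq> J" "f \<in> coord_ideal X"
  shows "\<exists>k. f ^ k \<in> J"
proof -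
  obtain k where "f ^ k \<in> Idl\<^bsub>rpoly_ring (Suc (nvars X))\<^esub> (coord_gens X)"
    using assms(4) unfolding coord_ideal_eq radical_def rpoly_ring_ops by auto
  then show ?thesis
    using ring.genideal_minimal[OF cring.axioms(1)[OF rpoly_cring] assms(2,3)] by auto
qed

lemma coord_ideal_radical:
  assumes "X \<in> CV" "f \<in> Rpoly (Suc (nvars X))" "f ^ k \<in> coord_ideal X"
  shows "f \<in> coord_ideal X"
proof -
  obtain l where "(f ^ k) ^ l \<in> Idl\<^bsub>rpoly_ring (Suc (nvars X))\<^esub> (coord_gens X)"
    using assms(3) unfolding coord_ideal_eq radical_def rpoly_ring_ops by auto
  then show ?thesis
    using assms(2) unfolding coord_ideal_eq radical_def rpoly_ring_ops
    by (auto simp flip: power_mult)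
qed

lemma eqs_in_coord_ideal: "X \<in> CV \<Longrightarrow> p \<in> eqs X \<Longrightarrow> p \<in> coord_ideal X"
  using coord_gens_in_ideal by (auto simp: coord_gens_def)

lemma inverse_in_coord_ideal: "X \<in> CV \<Longrightarrow> rvar (nvars X) * \<Prod>(ineqs X) - 1 \<in> coord_ideal X"
  using coord_gens_in_ideal by (auto simp: coord_gens_def)

text \<open>The inequations of \<open>Y\<close> enter into the construction of a morphism to \<open>Y\<close> only through the invertibility
  of their pullbacks, one by one. Working with units hides the product of the inequations, which is not
  multiplicative on unions of overlapping sets of inequations.\<close>

definition unit_on :: "bsa_formula \<Rightarrow> rpoly \<Rightarrow> bool" where
  "unit_on X q \<longleftrightarrow> (\<exists>u \<in> Rpoly (Suc (nvars X)). u * q - 1 \<in> coord_ideal X)"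

lemma unit_on_mult:
  assumes X: "X \<in> CV" and p: "unit_on X p" and q: "unit_on X q" "q \<in> Rpoly (Suc (nvars X))"
  shows "unit_on X (p * q)"
proof -
  obtain u v where u: "u \<in> Rpoly (Suc (nvars X))" "u * p - 1 \<in> coord_ideal X"
    and v: "v \<in> Rpoly (Suc (nvars X))" "v * q - 1 \<in> coord_ideal X"
    using p q by (auto simp: unit_on_def)
  have "(u * v) * (p * q) - 1 = (v * q) * (u * p - 1) + (v * q - 1)"
    by (simp add: algebra_simps)
  also have "\<dots> \<in> coord_ideal X"
    using coord_ideal_closed[OF X] u v q by simp
  finally show ?thesis unfolding unit_on_def using u v by (intro bexI[of _ "u * v"]) simp_all
qed

lemma unit_on_prod:
  assumes X: "X \<in> CV"
    and "\<And>q. q \<in> Q \<Longrightarrow> unit_on X (f q)" "\<And>q. q \<in> Q \<Longrightarrow> f q \<in> Rpoly (Suc (nvars X))"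
  shows "unit_on X (prod f Q)"
  using assms(2,3)
proof (induction Q rule: infinite_finite_induct)
  case (insert q Q)
  then show ?case by (auto intro!: unit_on_mult[OF X] Rpoly_prod)
next
  case (infinite Q)
  then show ?case using coord_ideal_closed(2)[OF X] by (auto simp: unit_on_def intro!: bexI[of _ 1])
next
  case empty
  then show ?case using coord_ideal_closed(2)[OF X] by (auto simp: unit_on_def intro!: bexI[of _ 1])
qed

lemma ineqs_unit_on:
  assumes X: "X \<in> CV" and q: "q \<in> ineqs X"
  shows "unit_on X q"
proof -
  have "\<Prod>(ineqs X) = q * \<Prod>(ineqs X - {q})"
    using prod.remove[OF CVD(6)[OF X] q, of "\<lambda>x. x"] by simp
  then have "(rvar (nvars X) * \<Prod>(ineqs X - {q})) * q - 1 \<in> coord_ideal X"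
    using inverse_in_coord_ideal[OF X] by (simp add: ac_simps)
  moreover have "rvar (nvars X) * \<Prod>(ineqs X - {q}) \<in> Rpoly (Suc (nvars X))"
    using CVD(4)[OF X] by (auto intro!: Rpoly_closed Rpoly_prod intro: Rpoly_Suc)
  ultimately show ?thesis unfolding unit_on_def by blast
qed

text \<open>\<open>morphism X Y f\<close>: the tuple \<open>f\<close> of polynomials on \<open>X\<close>, whose last entry is the value of the
  auxiliary variable of \<open>Y\<close>, represents a morphism of schemes from \<open>X\<close> to \<open>Y\<close>.\<close>

definition morphism :: "bsa_formula \<Rightarrow> bsa_formula \<Rightarrow> (nat \<Rightarrow> rpoly) \<Rightarrow> bool" where
  "morphism X Y f \<longleftrightarrow>
     (\<forall>i < Suc (nvars Y). f i \<in> Rpoly (Suc (nvars X))) \<and> subst f ` coord_gens Y \<subseteq> coord_ideal X"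

lemma morphism_subst_closed:
  "morphism X Y f \<Longrightarrow> p \<in> Rpoly (Suc (nvars Y)) \<Longrightarrow> subst f p \<in> Rpoly (Suc (nvars X))"
  by (rule subst_closed) (auto simp: morphism_def)

lemma morphism_coord_ideal:
  assumes X: "X \<in> CV" and Y: "Y \<in> CV" and f: "morphism X Y f" and p: "p \<in> coord_ideal Y"
  shows "subst f p \<in> coord_ideal X"
proof -
  let ?J = "{p \<in> Rpoly (Suc (nvars Y)). subst f p \<in> coord_ideal X}"
  have "ideal ?J (rpoly_ring (Suc (nvars Y)))"
    using coord_ideal_closed[OF X] morphism_subst_closed[OF f]
    unfolding rpoly_ring_def mpoly_ideal_iff by (auto simp flip: rpoly_ring_def)
  moreover have "coord_gens Y \<subseteq> ?J"
    using f coord_gens_closed[OF Y] by (auto simp: morphism_def)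
  ultimately obtain k where "p ^ k \<in> ?J" using coord_ideal_minimal[OF Y _ _ p] by blast
  then have "subst f p ^ k \<in> coord_ideal X" by simp
  then show ?thesis
    using coord_ideal_radical[OF X morphism_subst_closed[OF f]] p coord_ideal_closed(1)[OF Y] by blast
qed

lemma morphism_unit_on:
  assumes X: "X \<in> CV" and Y: "Y \<in> CV" and f: "morphism X Y f" and q: "unit_on Y q"
  shows "unit_on X (subst f q)"
proof -
  obtain u where u: "u \<in> Rpoly (Suc (nvars Y))" "u * q - 1 \<in> coord_ideal Y"
    using q by (auto simp: unit_on_def)
  have "subst f u * subst f q - 1 \<in> coord_ideal X"
    using morphism_coord_ideal[OF X Y f u(2)] by simp
  then show ?thesis unfolding unit_on_def using morphism_subst_closed[OF f u(1)] by blast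
qed

text \<open>A morphism to \<open>Y\<close> is given by the images of the honest coordinates alone: the auxiliary variable
  goes to an inverse of the product of the pulled back inequations.\<close>

lemma morphism_extend:
  assumes X: "X \<in> CV" and Y: "Y \<in> CV"
    and f: "\<And>i. i < nvars Y \<Longrightarrow> f i \<in> Rpoly (Suc (nvars X))"
    and eqs: "\<And>p. p \<in> eqs Y \<Longrightarrow> subst f p \<in> coord_ideal X"
    and ineqs: "\<And>q. q \<in> ineqs Y \<Longrightarrow> unit_on X (subst f q)"
  obtains g where "morphism X Y g" "\<And>i. i < nvars Y \<Longrightarrow> g i = f i"
proof -
  have "unit_on X (\<Prod>q \<in> ineqs Y. subst f q)"
    by (rule unit_on_prod[OF X ineqs]) (use CVD(4)[OF Y] in \<open>auto intro!: subst_closed f\<close>)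
  then obtain u where u: "u \<in> Rpoly (Suc (nvars X))"
    and uq: "u * (\<Prod>q \<in> ineqs Y. subst f q) - 1 \<in> coord_ideal X"
    by (auto simp: unit_on_def)
  define g where "g = f(nvars Y := u)"
  have gf: "subst g p = subst f p" if "p \<in> Rpoly (nvars Y)" for p
    by (rule subst_cong[OF that]) (simp add: g_def)
  have "(\<Prod>q \<in> ineqs Y. subst g q) = (\<Prod>q \<in> ineqs Y. subst f q)"
    using CVD(4)[OF Y] by (intro prod.cong) (auto simp: gf)
  then have "subst g (rvar (nvars Y) * \<Prod>(ineqs Y) - 1) \<in> coord_ideal X"
    using uq by (simp add: subst_prod g_def)
  moreover have "subst g p \<in> coord_ideal X" if "p \<in> eqs Y" for p
    using CVD(3)[OF Y] eqs that by (auto simp: gf)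
  ultimately have "morphism X Y g"
    using f u by (auto simp: morphism_def coord_gens_def less_Suc_eq g_def)
  then show thesis using that by (simp add: g_def)
qed

lemma coord_ideal_mult_cong:
  assumes X: "X \<in> CV" and "a - b \<in> coord_ideal X" "c - d \<in> coord_ideal X"
    and "b \<in> Rpoly (Suc (nvars X))" "c \<in> Rpoly (Suc (nvars X))"
  shows "a * c - b * d \<in> coord_ideal X"
proof -
  have "a * c - b * d = (a - b) * c + b * (c - d)" by (simp add: algebra_simps)
  also have "\<dots> \<in> coord_ideal X" using assms coord_ideal_closed[OF X] by simp
  finally show ?thesis .
qed

text \<open>The value of the auxiliary variable is the inverse of the product of the inequations, and
  inverses are unique.\<close>

lemma morphism_unique:
  assumes X: "X \<in> CV" and Y: "Y \<in> CV" and f: "morphism X Y f" and g: "morphism X Y g"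
    and eq: "\<And>i. i < nvars Y \<Longrightarrow> f i - g i \<in> coord_ideal X"
    and p: "p \<in> Rpoly (Suc (nvars Y))"
  shows "subst f p - subst g p \<in> coord_ideal X"
proof -
  let ?I = "coord_ideal X"
  note I = coord_ideal_closed[OF X]
  have base: "subst f p - subst g p \<in> ?I"
    if "p \<in> Rpoly n" "n \<le> Suc (nvars Y)" "\<And>i. i < n \<Longrightarrow> f i - g i \<in> ?I" for p n
    using that(1)
  proof (induction rule: rpoly_induct)
    case (add p q)
    then have "(subst f p - subst g p) + (subst f q - subst g q) \<in> ?I" using I(3) by simp
    then show ?case by (simp add: algebra_simps)
  next
    case (mult p q)
    then have "p \<in> Rpoly (Suc (nvars Y))" "q \<in> Rpoly (Suc (nvars Y))"
      using Rpoly_mono[OF that(2)] by auto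
    with mult show ?case
      using coord_ideal_mult_cong[OF X] morphism_subst_closed[OF f] morphism_subst_closed[OF g] by simp
  qed (simp_all add: that I(2))
  let ?t = "nvars Y" let ?q = "\<Prod>(ineqs Y)"
  have q: "?q \<in> Rpoly (nvars Y)" using CVD(4)[OF Y] by (auto intro!: Rpoly_prod)
  have "subst f ?q - subst g ?q \<in> ?I" by (rule base[OF q]) (simp_all add: eq)
  moreover have "f ?t * subst f ?q - 1 \<in> ?I" "g ?t * subst g ?q - 1 \<in> ?I"
    using morphism_coord_ideal[OF X Y _ inverse_in_coord_ideal[OF Y]] f g by force+
  moreover have "f ?t \<in> Rpoly (Suc (nvars X))" "g ?t \<in> Rpoly (Suc (nvars X))"
    using f g by (auto simp: morphism_def)
  moreover have "f ?t - g ?t = (g ?t * (f ?t * subst f ?q - 1) - f ?t * (g ?t * subst g ?q - 1))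
      - (f ?t * g ?t) * (subst f ?q - subst g ?q)"
    by (simp add: algebra_simps)
  ultimately have "f ?t - g ?t \<in> ?I" using I by simp
  with eq show ?thesis by (intro base[OF p]) (auto simp: less_Suc_eq)
qed

lemma morphism_comp:
  assumes X: "X \<in> CV" and Y: "Y \<in> CV" and Z: "Z \<in> CV"
    and f: "morphism X Y f" and g: "morphism Y Z g"
  shows "morphism X Z (\<lambda>i. subst f (g i))"
  unfolding morphism_def
proof (intro conjI allI impI image_subsetI)
  show "subst f (g i) \<in> Rpoly (Suc (nvars X))" if "i < Suc (nvars Z)" for i
    using g that by (intro morphism_subst_closed[OF f]) (simp add: morphism_def)
  fix p assume "p \<in> coord_gens Z"
  then have "p \<in> coord_ideal Z" using coord_gens_in_ideal[OF Z] by auto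
  then show "subst (\<lambda>i. subst f (g i)) p \<in> coord_ideal X"
    using morphism_coord_ideal[OF X Y f] morphism_coord_ideal[OF Y Z g]
    by (simp flip: subst_subst)
qed

lemma morphism_id: "X \<in> CV \<Longrightarrow> morphism X X rvar"
  using coord_gens_in_ideal[of X] by (auto simp: morphism_def)

text \<open>Only the honest coordinates are compared: by \<open>morphism_unique\<close>, a composite that fixes them
  modulo the ideal also fixes the auxiliary variable.\<close>

definition inverse_on :: "bsa_formula \<Rightarrow> (nat \<Rightarrow> rpoly) \<Rightarrow> (nat \<Rightarrow> rpoly) \<Rightarrow> bool" where
  "inverse_on X f g \<longleftrightarrow> (\<forall>i < nvars X. subst f (g i) - rvar i \<in> coord_ideal X)"

lemma inverse_onD:
  assumes X: "X \<in> CV" and Y: "Y \<in> CV" and f: "morphism X Y f" and g: "morphism Y X g"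
    and inv: "inverse_on X f g" and p: "p \<in> Rpoly (Suc (nvars X))"
  shows "subst f (subst g p) - p \<in> coord_ideal X"
  using morphism_unique[OF X X morphism_comp[OF X Y X f g] morphism_id[OF X] _ p] inv
  by (simp add: inverse_on_def subst_subst)

abbreviation coord_class :: "bsa_formula \<Rightarrow> rpoly \<Rightarrow> rpoly set" where
  "coord_class X p \<equiv> coord_ideal X +>\<^bsub>rpoly_ring (Suc (nvars X))\<^esub> p"

lemma coord_class_eq_iff:
  assumes "X \<in> CV" "p \<in> Rpoly (Suc (nvars X))" "q \<in> Rpoly (Suc (nvars X))"
  shows "coord_class X p = coord_class X q \<longleftrightarrow> p - q \<in> coord_ideal X"
  using ring.quotient_eq_iff_same_a_r_cos[OF cring.axioms(1)[OF rpoly_cring] coord_ideal_ideal[OF assms(1)]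
      assms(2,3)] assms
  by (simp add: rpoly_ring_ops)

lemma coord_class_hom:
  assumes "X \<in> CV"
  shows "ring_hom_ring (rpoly_ring (Suc (nvars X))) (coord_ring X) (coord_class X)"
  unfolding coord_ring_def by (rule ideal.rcos_ring_hom_ring[OF coord_ideal_ideal[OF assms]])

lemma coord_ring_carrier:
  "carrier (coord_ring X) = coord_class X ` Rpoly (Suc (nvars X))"
  by (auto simp: coord_ring_def FactRing_def A_RCOSETS_def' )

lemma coord_class_zero: "X \<in> CV \<Longrightarrow> p \<in> Rpoly (Suc (nvars X)) \<Longrightarrow>
    coord_class X p = \<zero>\<^bsub>coord_ring X\<^esub> \<longleftrightarrow> p \<in> coord_ideal X"
  using coord_class_eq_iff[of X p 0] ring_hom_ring.homh[OF coord_class_hom, of X]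
    ring_hom_zero[OF _ cring.axioms(1)[OF rpoly_cring] ring_hom_ring.axioms(2)[OF coord_class_hom], of _ "Suc (nvars X)" X]
  by simp

text \<open>Mutually inverse morphisms on the schemes give an isomorphism of the coordinate rings: the
  composite \<open>\<real>[Y, T] \<rightarrow> \<real>[X, T] \<rightarrow> coord_ring X\<close> is onto with kernel \<open>coord_ideal Y\<close>.\<close>

lemma iso_over_realI:
  assumes X: "X \<in> CV" and Y: "Y \<in> CV" and f: "morphism X Y f" and g: "morphism Y X g"
    and fg: "inverse_on X f g" and gf: "inverse_on Y g f"
  shows "iso_over_real X Y"
proof -
  let ?R = "rpoly_ring (Suc (nvars Y))" and ?S = "coord_ring X"
  let ?h = "\<lambda>p. coord_class X (subst f p)"
  interpret c: ring_hom_ring "rpoly_ring (Suc (nvars X))" "coord_ring X" "coord_class X"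
    by (rule coord_class_hom[OF X])
  have hom: "ring_hom_ring ?R ?S ?h"
  proof (rule ring_hom_ringI2)
    show "?h \<in> ring_hom ?R ?S"
      using morphism_subst_closed[OF f] c.hom_mult c.hom_add c.hom_one
      by (intro ring_hom_memI) simp_all
  qed (use cring.axioms(1)[OF rpoly_cring] c.S.ring_axioms in auto)
  have ker: "a_kernel ?R ?S ?h = coord_ideal Y"
  proof -
    have "subst f p \<in> coord_ideal X \<longleftrightarrow> p \<in> coord_ideal Y" if p: "p \<in> Rpoly (Suc (nvars Y))" for p
    proof
      assume "subst f p \<in> coord_ideal X"
      then have "subst g (subst f p) \<in> coord_ideal Y" by (rule morphism_coord_ideal[OF Y X g])
      from coord_ideal_closed(4)[OF Y this inverse_onD[OF Y X g f gf p]]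
      show "p \<in> coord_ideal Y" unfolding diff_diff_eq2 by (simp only: add_diff_cancel_left')
    qed (rule morphism_coord_ideal[OF X Y f])
    then have "?h p = \<zero>\<^bsub>?S\<^esub> \<longleftrightarrow> p \<in> coord_ideal Y" if "p \<in> Rpoly (Suc (nvars Y))" for p
      using coord_class_zero[OF X morphism_subst_closed[OF f that]] that by blast
    then show ?thesis
      unfolding a_kernel_def' using coord_ideal_closed(1)[OF Y] by blast
  qed
  have surj: "?h ` Rpoly (Suc (nvars Y)) = carrier ?S"
  proof (intro equalityI subsetI)
    fix c assume "c \<in> carrier ?S"
    then obtain p where p: "p \<in> Rpoly (Suc (nvars X))" "c = coord_class X p"
      by (auto simp: coord_ring_carrier)
    have "?h (subst g p) = c"
      unfolding p(2)
      by (rule coord_class_eq_iff[OF X _ p(1), THEN iffD2, OF _ inverse_onD[OF X Y f g fg p(1)]])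
        (intro morphism_subst_closed[OF f] morphism_subst_closed[OF g] p(1))
    then show "c \<in> ?h ` Rpoly (Suc (nvars Y))" using morphism_subst_closed[OF g p(1)] by blast
  qed (use morphism_subst_closed[OF f] in \<open>auto simp: coord_ring_carrier\<close>)
  let ?H = "\<lambda>c. the_elem (?h ` c)"
  have "?H \<in> ring_iso (coord_ring Y) ?S"
    using ring_hom_ring.FactRing_iso_set[OF hom surj] unfolding ker by (simp only: coord_ring_def)
  moreover have "?H (coord_const Y c) = coord_const X c" for c
    using ring_hom_ring.the_elem_simp[OF hom, of "rconst c"] unfolding ker coord_const_def by simp
  ultimately show ?thesis unfolding iso_over_real_def by (intro bexI[of _ ?H] allI)
qed

text \<open>A homomorphism out of a quotient of a polynomial ring is determined by the images of the constants
  and of the variables; lifting the latter to polynomials gives the morphism. Compatibility with the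
  constants is essential, since \<open>\<real>\<close>-algebra homomorphisms are meant.\<close>

lemma coord_ring_hom_morphism:
  assumes X: "X \<in> CV" and Y: "Y \<in> CV" and h: "h \<in> ring_hom (coord_ring Y) (coord_ring X)"
    and const: "\<And>c. h (coord_const Y c) = coord_const X c"
  obtains f where "morphism X Y f"
    "\<And>p. p \<in> Rpoly (Suc (nvars Y)) \<Longrightarrow> h (coord_class Y p) = coord_class X (subst f p)"
proof -
  interpret cX: ring_hom_ring "rpoly_ring (Suc (nvars X))" "coord_ring X" "coord_class X"
    by (rule coord_class_hom[OF X])
  interpret cY: ring_hom_ring "rpoly_ring (Suc (nvars Y))" "coord_ring Y" "coord_class Y"
    by (rule coord_class_hom[OF Y])
  interpret h: ring_hom_ring "coord_ring Y" "coord_ring X" h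
    by (rule ring_hom_ringI2[OF cY.S.ring_axioms cX.S.ring_axioms h])
  have "\<exists>p. p \<in> Rpoly (Suc (nvars X)) \<and> h (coord_class Y (rvar i)) = coord_class X p"
    if "i < Suc (nvars Y)" for i
  proof -
    have "h (coord_class Y (rvar i)) \<in> carrier (coord_ring X)"
      using that cY.hom_closed h.hom_closed by simp
    then show ?thesis by (auto simp: coord_ring_carrier)
  qed
  then obtain f where fR: "\<And>i. i < Suc (nvars Y) \<Longrightarrow> f i \<in> Rpoly (Suc (nvars X))"
    and fh: "\<And>i. i < Suc (nvars Y) \<Longrightarrow> h (coord_class Y (rvar i)) = coord_class X (f i)"
    by metis
  have hf: "h (coord_class Y p) = coord_class X (subst f p)" if "p \<in> Rpoly (Suc (nvars Y))" for p
    using that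
  proof (induction rule: rpoly_induct)
    case (const c)
    then show ?case using assms(4)[of c] by (simp add: coord_const_def)
  next
    case (add p q)
    have "subst f p \<in> Rpoly (Suc (nvars X))" "subst f q \<in> Rpoly (Suc (nvars X))"
      using add fR by (auto intro: subst_closed)
    with add show ?case
      using cY.hom_add[of p q] cX.hom_add[of "subst f p" "subst f q"] h.hom_add cY.hom_closed by simp
  next
    case (mult p q)
    have "subst f p \<in> Rpoly (Suc (nvars X))" "subst f q \<in> Rpoly (Suc (nvars X))"
      using mult fR by (auto intro: subst_closed)
    with mult show ?case
      using cY.hom_mult[of p q] cX.hom_mult[of "subst f p" "subst f q"] h.hom_mult cY.hom_closed by simp
  qed (simp add: fh)
  have "subst f p \<in> coord_ideal X" if "p \<in> coord_gens Y" for p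
  proof -
    have p: "p \<in> Rpoly (Suc (nvars Y))" "p \<in> coord_ideal Y"
      using that coord_gens_closed[OF Y] coord_gens_in_ideal[OF Y] by auto
    then have "coord_class X (subst f p) = \<zero>\<^bsub>coord_ring X\<^esub>"
      using hf[OF p(1)] coord_class_zero[OF Y p(1)] by simp
    moreover have "subst f p \<in> Rpoly (Suc (nvars X))" using p(1) fR by (rule subst_closed)
    ultimately show ?thesis using coord_class_zero[OF X, of "subst f p"] by simp
  qed
  with fR have "morphism X Y f" by (auto simp: morphism_def)
  with hf show thesis using that by blast
qed

lemma iso_over_realE:
  assumes X: "X \<in> CV" and Y: "Y \<in> CV" and iso: "iso_over_real X Y"
  obtains f g where "morphism X Y f" "morphism Y X g" "inverse_on X f g" "inverse_on Y g f"
proof -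
  obtain h where h: "h \<in> ring_iso (coord_ring Y) (coord_ring X)"
    and const: "\<And>c. h (coord_const Y c) = coord_const X c"
    using iso by (auto simp: iso_over_real_def)
  interpret cX: ring_hom_ring "rpoly_ring (Suc (nvars X))" "coord_ring X" "coord_class X"
    by (rule coord_class_hom[OF X])
  interpret cY: ring_hom_ring "rpoly_ring (Suc (nvars Y))" "coord_ring Y" "coord_class Y"
    by (rule coord_class_hom[OF Y])
  let ?k = "inv_into (carrier (coord_ring Y)) h"
  have k: "?k \<in> ring_iso (coord_ring X) (coord_ring Y)"
    by (rule ring_iso_set_sym[OF cY.S.ring_axioms h])
  have bij: "bij_betw h (carrier (coord_ring Y)) (carrier (coord_ring X))"
    using h by (simp add: ring_iso_def)
  have kconst: "?k (coord_const X c) = coord_const Y c" for c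
  proof -
    have "coord_const Y c \<in> carrier (coord_ring Y)"
      unfolding coord_const_def coord_ring_carrier by (rule imageI) simp
    then have "?k (h (coord_const Y c)) = coord_const Y c"
      using bij by (simp add: bij_betw_def)
    then show ?thesis by (simp add: const)
  qed
  have hh: "h \<in> ring_hom (coord_ring Y) (coord_ring X)" and kh: "?k \<in> ring_hom (coord_ring X) (coord_ring Y)"
    using h k by (auto simp: ring_iso_def)
  obtain f where f: "morphism X Y f"
    "\<And>p. p \<in> Rpoly (Suc (nvars Y)) \<Longrightarrow> h (coord_class Y p) = coord_class X (subst f p)"
    using coord_ring_hom_morphism[OF X Y hh const] by blast
  obtain g where g: "morphism Y X g"
    "\<And>p. p \<in> Rpoly (Suc (nvars X)) \<Longrightarrow> ?k (coord_class X p) = coord_class Y (subst g p)"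
    using coord_ring_hom_morphism[OF Y X kh kconst] by blast
  have "inverse_on X f g"
    unfolding inverse_on_def
  proof (intro allI impI)
    fix i assume i: "i < nvars X"
    then have r: "rvar i \<in> Rpoly (Suc (nvars X))" by simp
    have gi: "g i \<in> Rpoly (Suc (nvars Y))" using g(1) i by (simp add: morphism_def)
    have "coord_class X (subst f (g i)) = h (?k (coord_class X (rvar i)))"
      using f(2)[OF gi] g(2)[OF r] by simp
    also have "\<dots> = coord_class X (rvar i)"
      using bij r by (intro bij_betw_inv_into_right) (auto simp: coord_ring_carrier)
    finally show "subst f (g i) - rvar i \<in> coord_ideal X"
      using coord_class_eq_iff[OF X _ r] morphism_subst_closed[OF f(1) gi] by blast
  qed
  moreover have "inverse_on Y g f"
    unfolding inverse_on_def
  proof (intro allI impI)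
    fix i assume i: "i < nvars Y"
    then have r: "rvar i \<in> Rpoly (Suc (nvars Y))" by simp
    have fi: "f i \<in> Rpoly (Suc (nvars X))" using f(1) i by (simp add: morphism_def)
    have "coord_class Y (subst g (f i)) = ?k (h (coord_class Y (rvar i)))"
      using g(2)[OF fi] f(2)[OF r] by simp
    also have "\<dots> = coord_class Y (rvar i)"
      using bij r by (intro bij_betw_inv_into_left) (auto simp: coord_ring_carrier)
    finally show "subst g (f i) - rvar i \<in> coord_ideal Y"
      using coord_class_eq_iff[OF Y _ r] morphism_subst_closed[OF g(1) fi] by blast
  qed
  ultimately show thesis using that f(1) g(1) by blast
qed

section \<open>Isomorphisms of constructible varieties\<close>

lemma subst_contraction_prime:
  assumes P: "primeideal P (rpoly_ring m)" and f: "\<And>i. i < n \<Longrightarrow> f i \<in> Rpoly m"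
  shows "primeideal {p \<in> Rpoly n. subst f p \<in> P} (rpoly_ring n)"
proof -
  have cl: "subst f p \<in> Rpoly m" if "p \<in> Rpoly n" for p using subst_closed[OF that f] .
  show ?thesis
    using P cl unfolding rpoly_ring_def mpoly_primeideal_iff mpoly_ideal_iff
    by (auto simp flip: rpoly_ring_def)
qed

text \<open>On a prime ideal above \<open>coord_ideal X\<close> no inequation of \<open>X\<close> can vanish, because it is a unit there.\<close>

lemma locus_contraction:
  assumes X: "X \<in> CV" and P: "primeideal P (rpoly_ring (Suc (nvars X)))" and sub: "coord_ideal X \<subseteq> P"
  shows "{p \<in> Rpoly (nvars X). p \<in> P} \<in> locus X"
proof -
  have one: "1 \<notin> P" using P by (auto simp: rpoly_ring_def mpoly_primeideal_iff)
  have ide: "ideal P (rpoly_ring (Suc (nvars X)))" using P by (rule primeideal.axioms)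
  note PI = rpoly_ideal_closed[OF ide]
  have "q \<notin> P" if qX: "q \<in> ineqs X" for q
  proof
    assume q: "q \<in> P"
    obtain u where u: "u \<in> Rpoly (Suc (nvars X))" "u * q - 1 \<in> coord_ideal X"
      using ineqs_unit_on[OF X qX] by (auto simp: unit_on_def)
    have "u * q - (u * q - 1) \<in> P" using PI(4)[OF PI(5)[OF q u(1)]] u(2) sub by blast
    then show False using one by simp
  qed
  moreover have "primeideal {p \<in> Rpoly (nvars X). p \<in> P} (rpoly_ring (nvars X))"
    using subst_contraction_prime[OF P, of "nvars X" rvar] by simp
  ultimately show ?thesis
    using CVD(3)[OF X] eqs_in_coord_ideal[OF X] sub by (auto simp: locus_def)
qed

lemma coord_ideal_memI:
  assumes X: "X \<in> CV" and f: "f \<in> Rpoly (Suc (nvars X))"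
    and "\<And>P. primeideal P (rpoly_ring (Suc (nvars X))) \<Longrightarrow> coord_ideal X \<subseteq> P \<Longrightarrow> f \<in> P"
  shows "f \<in> coord_ideal X"
proof (rule ccontr)
  assume "f \<notin> coord_ideal X"
  then have "f ^ k \<notin> coord_ideal X" for k using coord_ideal_radical[OF X f] by blast
  then obtain P where "primeideal P (rpoly_ring (Suc (nvars X)))" "coord_ideal X \<subseteq> P" "f \<notin> P"
    using prime_ideal_avoiding[OF coord_ideal_ideal[OF X, unfolded rpoly_ring_def] f[unfolded rpoly_ring_def]]
    unfolding rpoly_ring_def by blast
  then show False using assms(3) by blast
qed

text \<open>Otherwise \<open>q\<close> and \<open>coord_ideal X\<close> generate a proper ideal, which some prime ideal contains.\<close>

lemma unit_onI:
  assumes X: "X \<in> CV" and q: "q \<in> Rpoly (Suc (nvars X))"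
    and avoid: "\<And>P. primeideal P (rpoly_ring (Suc (nvars X))) \<Longrightarrow> coord_ideal X \<subseteq> P \<Longrightarrow> q \<notin> P"
  shows "unit_on X q"
proof (rule ccontr)
  let ?R = "Rpoly (Suc (nvars X))"
  assume non_unit: "\<not> unit_on X q"
  note I = coord_ideal_closed[OF X]
  define J where "J = {a + u * q | a u. a \<in> coord_ideal X \<and> u \<in> ?R}"
  have JI: "a + u * q \<in> J" if "a \<in> coord_ideal X" "u \<in> ?R" for a u
    using that by (auto simp: J_def)
  have J: "ideal J (rpoly_ring (Suc (nvars X)))"
    unfolding rpoly_ring_def mpoly_ideal_iff
    unfolding rpoly_ring_def[symmetric]
  proof (intro conjI ballI)
    show "J \<subseteq> ?R" using I(1) q by (auto simp: J_def)
    show "0 \<in> J" using JI[OF I(2) Rpoly_closed(1)] by simp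
    fix x assume "x \<in> J"
    then obtain a u where x: "x = a + u * q" "a \<in> coord_ideal X" "u \<in> ?R" by (auto simp: J_def)
    { fix y assume "y \<in> J"
      then obtain b v where y: "y = b + v * q" "b \<in> coord_ideal X" "v \<in> ?R" by (auto simp: J_def)
      have "x + y = (a + b) + (u + v) * q" using x y by (simp add: algebra_simps)
      then show "x + y \<in> J" using JI[OF I(3)[OF x(2) y(2)] Rpoly_closed(3)[OF x(3) y(3)]] by simp }
    { fix r assume r: "r \<in> ?R"
      have "r * x = r * a + (r * u) * q" using x by (simp add: algebra_simps)
      then show "r * x \<in> J" using JI[OF I(5)[OF x(2) r] Rpoly_closed(5)[OF r x(3)]] by simp }
  qed
  have "1 \<notin> J"
  proof
    assume "1 \<in> J"
    then obtain a u where a: "1 = a + u * q" "a \<in> coord_ideal X" "u \<in> ?R" by (auto simp: J_def)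
    have "u * q - 1 = 0 - a" by (subst a(1)) simp
    also have "\<dots> \<in> coord_ideal X" by (rule I(4)[OF I(2) a(2)])
    finally show False using non_unit a(3) by (auto simp: unit_on_def)
  qed
  then obtain P where P: "primeideal P (rpoly_ring (Suc (nvars X)))" "J \<subseteq> P"
    using prime_ideal_avoiding[OF J[unfolded rpoly_ring_def] mpoly_carrier_one]
    unfolding rpoly_ring_def by auto
  have "coord_ideal X \<subseteq> J" using JI[OF _ Rpoly_closed(1)] by auto
  moreover have "q \<in> J" using JI[OF I(2) Rpoly_closed(2)] by simp
  ultimately show False using avoid[OF P(1)] P(2) by blast
qed

text \<open>The equations of \<open>Y\<close> lie in every prime ideal above \<open>coord_ideal X\<close>, hence in this radical ideal;
  the inequations of \<open>Y\<close> lie in none, hence are units on \<open>X\<close>.\<close>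

lemma locus_subset_morphism:
  assumes X: "X \<in> CV" and Y: "Y \<in> CV" and n: "nvars X = nvars Y" and sub: "locus X \<subseteq> locus Y"
  obtains f where "morphism X Y f" "\<And>i. i < nvars Y \<Longrightarrow> f i = rvar i"
proof (rule morphism_extend[OF X Y, of rvar])
  have loc: "{p \<in> Rpoly (nvars X). p \<in> P} \<in> locus Y"
    if "primeideal P (rpoly_ring (Suc (nvars X)))" "coord_ideal X \<subseteq> P" for P
    using locus_contraction[OF X that] sub by blast
  show "subst rvar p \<in> coord_ideal X" if p: "p \<in> eqs Y" for p
    unfolding subst_rvar_id
  proof (rule coord_ideal_memI[OF X])
    show "p \<in> Rpoly (Suc (nvars X))" using p CVD(3)[OF Y] n by (auto intro: Rpoly_Suc)
    show "p \<in> P" if "primeideal P (rpoly_ring (Suc (nvars X)))" "coord_ideal X \<subseteq> P" for P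
      using loc[OF that] p by (auto simp: locus_def)
  qed
  show "unit_on X (subst rvar q)" if q: "q \<in> ineqs Y" for q
    unfolding subst_rvar_id
  proof (rule unit_onI[OF X])
    have qR: "q \<in> Rpoly (nvars X)" using q CVD(4)[OF Y] n by auto
    then show "q \<in> Rpoly (Suc (nvars X))" by (rule Rpoly_Suc)
    show "q \<notin> P" if "primeideal P (rpoly_ring (Suc (nvars X)))" "coord_ideal X \<subseteq> P" for P
      using loc[OF that] q qR by (auto simp: locus_def)
  qed
qed (use n in auto)

lemma same_locus_iso:
  assumes X: "X \<in> CV" and Y: "Y \<in> CV" and n: "nvars X = nvars Y" and eq: "locus X = locus Y"
  shows "iso_over_real X Y"
proof -
  obtain f where f: "morphism X Y f" "\<And>i. i < nvars Y \<Longrightarrow> f i = rvar i"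
    using locus_subset_morphism[OF X Y n] eq by blast
  obtain g where g: "morphism Y X g" "\<And>i. i < nvars X \<Longrightarrow> g i = rvar i"
    using locus_subset_morphism[OF Y X n[symmetric]] eq by blast
  show ?thesis
    using coord_ideal_closed(2)[OF X] coord_ideal_closed(2)[OF Y]
    by (intro iso_over_realI[OF X Y f(1) g(1)]) (auto simp: inverse_on_def f(2) g(2) n)
qed

section \<open>Products\<close>

text \<open>The possible positions of the variables of two factors in a product: consecutive as in
  \<^const>\<open>var_prod\<close>, or interleaved as in the product relation for formulas.\<close>

definition complementary :: "nat \<Rightarrow> (nat \<Rightarrow> nat) \<Rightarrow> nat \<Rightarrow> (nat \<Rightarrow> nat) \<Rightarrow> bool" where
  "complementary n \<sigma> m \<tau> \<longleftrightarrow> inj_on \<sigma> {..<n} \<and> inj_on \<tau> {..<m} \<and>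
     \<sigma> ` {..<n} \<inter> \<tau> ` {..<m} = {} \<and> \<sigma> ` {..<n} \<union> \<tau> ` {..<m} = {..<n + m}"

lemma complementary_less:
  assumes "complementary n \<sigma> m \<tau>"
  shows "i < n \<Longrightarrow> \<sigma> i < n + m" "j < m \<Longrightarrow> \<tau> j < n + m"
  using assms by (auto simp: complementary_def)

lemma complementary_shift: "complementary n id m (\<lambda>j. n + j)"
proof -
  have "k \<in> (\<lambda>j. n + j) ` {..<m}" if "n \<le> k" "k < n + m" for k
    using that by (intro image_eqI[of _ _ "k - n"]) auto
  then show ?thesis
    by (auto simp: complementary_def inj_on_def) (meson not_le)
qed

lemma complementary_sym: "complementary n \<sigma> m \<tau> \<Longrightarrow> complementary m \<tau> n \<sigma>"
  by (auto simp: complementary_def add.commute)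

lemma join_sym: "join \<sigma> X \<tau> Y = join \<tau> Y \<sigma> X"
  by (simp add: join_def Un_commute add.commute)

lemma join_simps [simp]:
  "nvars (join \<sigma> X \<tau> Y) = nvars X + nvars Y"
  "eqs (join \<sigma> X \<tau> Y) = rename \<sigma> ` eqs X \<union> rename \<tau> ` eqs Y"
  "ineqs (join \<sigma> X \<tau> Y) = rename \<sigma> ` ineqs X \<union> rename \<tau> ` ineqs Y"
  "pos (join \<sigma> X \<tau> Y) = rename \<sigma> ` pos X \<union> rename \<tau> ` pos Y"
  by (simp_all add: join_def)

lemma join_bsa_formulas:
  assumes "A \<in> bsa_formulas" "B \<in> bsa_formulas" and c: "complementary (nvars A) \<sigma> (nvars B) \<tau>"
  shows "join \<sigma> A \<tau> B \<in> bsa_formulas"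
proof -
  have "rename \<sigma> p \<in> Rpoly (nvars A + nvars B)" if "p \<in> Rpoly (nvars A)" for p
    using that complementary_less(1)[OF c] by (rule rename_closed)
  moreover have "rename \<tau> p \<in> Rpoly (nvars A + nvars B)" if "p \<in> Rpoly (nvars B)" for p
    using that complementary_less(2)[OF c] by (rule rename_closed)
  ultimately show ?thesis
    using assms(1,2) by (auto simp: bsa_formulas_def subset_iff)
qed

lemma join_CV:
  assumes "X \<in> CV" "Y \<in> CV" "complementary (nvars X) \<sigma> (nvars Y) \<tau>"
  shows "join \<sigma> X \<tau> Y \<in> CV"
  using assms join_bsa_formulas[of X Y \<sigma> \<tau>] by (simp add: constructible_varieties_def)

lemma join_morphism:
  assumes X: "X \<in> CV" and Y: "Y \<in> CV"
    and c: "complementary (nvars X) \<sigma> (nvars Y) \<tau>" and c': "complementary (nvars X) \<sigma>' (nvars Y) \<tau>'"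
  obtains f where "morphism (join \<sigma> X \<tau> Y) (join \<sigma>' X \<tau>' Y) f"
    "\<And>i. i < nvars X \<Longrightarrow> f (\<sigma>' i) = rvar (\<sigma> i)" "\<And>j. j < nvars Y \<Longrightarrow> f (\<tau>' j) = rvar (\<tau> j)"
proof -
  let ?n = "nvars X" and ?m = "nvars Y"
  let ?J = "join \<sigma> X \<tau> Y" and ?J' = "join \<sigma>' X \<tau>' Y"
  have J: "?J \<in> CV" and J': "?J' \<in> CV" using join_CV X Y c c' by auto
  define \<rho> where "\<rho> k = (if k \<in> \<sigma>' ` {..<?n} then \<sigma> (inv_into {..<?n} \<sigma>' k) else \<tau> (inv_into {..<?m} \<tau>' k))" for k
  have \<rho>1: "\<rho> (\<sigma>' i) = \<sigma> i" if "i < ?n" for i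
    using that c' by (simp add: \<rho>_def complementary_def)
  have \<rho>2: "\<rho> (\<tau>' j) = \<tau> j" if "j < ?m" for j
  proof -
    have "\<tau>' j \<notin> \<sigma>' ` {..<?n}" using that c' by (auto simp: complementary_def)
    then show ?thesis using that c' by (simp add: \<rho>_def complementary_def)
  qed
  have r1: "subst (\<lambda>k. rvar (\<rho> k)) (rename \<sigma>' p) = rename \<sigma> p" if "p \<in> Rpoly ?n" for p
    unfolding rename_eq_subst subst_subst by (rule subst_cong[OF that]) (simp add: \<rho>1)
  have r2: "subst (\<lambda>k. rvar (\<rho> k)) (rename \<tau>' p) = rename \<tau> p" if "p \<in> Rpoly ?m" for p
    unfolding rename_eq_subst subst_subst by (rule subst_cong[OF that]) (simp add: \<rho>2)
  note R = subsetD[OF CVD(3)[OF X]] subsetD[OF CVD(4)[OF X]] subsetD[OF CVD(3)[OF Y]] subsetD[OF CVD(4)[OF Y]]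
  obtain f where f: "morphism ?J ?J' f" "\<And>k. k < nvars ?J' \<Longrightarrow> f k = rvar (\<rho> k)"
  proof (rule morphism_extend[OF J J', of "\<lambda>k. rvar (\<rho> k)"])
    fix k assume "k < nvars ?J'"
    then have "k \<in> \<sigma>' ` {..<?n} \<union> \<tau>' ` {..<?m}" using c' by (simp add: complementary_def)
    then have "\<rho> k < ?n + ?m" using \<rho>1 \<rho>2 complementary_less[OF c] by auto
    then show "rvar (\<rho> k) \<in> Rpoly (Suc (nvars ?J))" by simp
  next
    fix p assume "p \<in> eqs ?J'"
    then have "subst (\<lambda>k. rvar (\<rho> k)) p \<in> eqs ?J" using r1 r2 R(1,3) by auto
    then show "subst (\<lambda>k. rvar (\<rho> k)) p \<in> coord_ideal ?J" by (rule eqs_in_coord_ideal[OF J])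
  next
    fix q assume "q \<in> ineqs ?J'"
    then have "subst (\<lambda>k. rvar (\<rho> k)) q \<in> ineqs ?J" using r1 r2 R(2,4) by auto
    then show "unit_on ?J (subst (\<lambda>k. rvar (\<rho> k)) q)" by (rule ineqs_unit_on[OF J])
  qed blast
  show thesis
    using f(2) \<rho>1 \<rho>2 complementary_less[OF c'] by (intro that[OF f(1)]) auto
qed

text \<open>Two placements of the variables differ by a permutation of the coordinates.\<close>

lemma join_iso:
  assumes X: "X \<in> CV" and Y: "Y \<in> CV"
    and c: "complementary (nvars X) \<sigma> (nvars Y) \<tau>" and c': "complementary (nvars X) \<sigma>' (nvars Y) \<tau>'"
  shows "iso_over_real (join \<sigma> X \<tau> Y) (join \<sigma>' X \<tau>' Y)"
proof -
  let ?J = "join \<sigma> X \<tau> Y" and ?J' = "join \<sigma>' X \<tau>' Y"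
  have J: "?J \<in> CV" and J': "?J' \<in> CV" using join_CV X Y c c' by auto
  obtain f where f: "morphism ?J ?J' f"
    "\<And>i. i < nvars X \<Longrightarrow> f (\<sigma>' i) = rvar (\<sigma> i)" "\<And>j. j < nvars Y \<Longrightarrow> f (\<tau>' j) = rvar (\<tau> j)"
    using join_morphism[OF X Y c c'] by blast
  obtain g where g: "morphism ?J' ?J g"
    "\<And>i. i < nvars X \<Longrightarrow> g (\<sigma> i) = rvar (\<sigma>' i)" "\<And>j. j < nvars Y \<Longrightarrow> g (\<tau> j) = rvar (\<tau>' j)"
    using join_morphism[OF X Y c' c] by blast
  have cover: "(\<exists>i < nvars X. k = \<sigma> i) \<or> (\<exists>j < nvars Y. k = \<tau> j)"
    if "complementary (nvars X) \<sigma> (nvars Y) \<tau>" "k < nvars X + nvars Y" for k \<sigma> \<tau>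
  proof -
    have "k \<in> \<sigma> ` {..<nvars X} \<union> \<tau> ` {..<nvars Y}" using that by (simp add: complementary_def)
    then show ?thesis by auto
  qed
  have "subst f (g k) = rvar k" if "k < nvars ?J" for k
    using cover[OF c, of k] that f(2,3) g(2,3) by auto
  moreover have "subst g (f k) = rvar k" if "k < nvars ?J'" for k
    using cover[OF c', of k] that f(2,3) g(2,3) by auto
  ultimately show ?thesis
    using coord_ideal_closed(2)[OF J] coord_ideal_closed(2)[OF J']
    by (intro iso_over_realI[OF J J' f(1) g(1)]) (auto simp: inverse_on_def)
qed

lemma var_prod_CV: "X \<in> CV \<Longrightarrow> Y \<in> CV \<Longrightarrow> var_prod X Y \<in> CV"
  unfolding var_prod_def by (rule join_CV) (simp_all add: complementary_shift)

text \<open>\<open>var_prod Y X\<close> is also a join of \<open>X\<close> and \<open>Y\<close>, with the variables of \<open>X\<close> placed last.\<close>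

lemma var_prod_commute_iso:
  assumes "X \<in> CV" "Y \<in> CV"
  shows "iso_over_real (var_prod X Y) (var_prod Y X)"
  unfolding var_prod_def join_sym[of id Y]
  by (intro join_iso assms complementary_shift complementary_sym[OF complementary_shift])

text \<open>The product of \<open>f\<close> with the identity of \<open>Y\<close>. The polynomials \<open>f i\<close> may contain the auxiliary variable of
  \<open>X\<close>, which is not a coordinate of \<open>X \<times> Y\<close>; the projection \<open>a\<close> replaces it by its value on the product.\<close>

lemma var_prod_morphism:
  assumes X: "X \<in> CV" and X': "X' \<in> CV" and Y: "Y \<in> CV" and f: "morphism X X' f"
  obtains a F where "morphism (var_prod X Y) X a" "\<And>i. i < nvars X \<Longrightarrow> a i = rvar i"
    "morphism (var_prod X Y) (var_prod X' Y) F"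
    "\<And>i. i < nvars X' \<Longrightarrow> F i = subst a (f i)"
    "\<And>j. j < nvars Y \<Longrightarrow> F (nvars X' + j) = rvar (nvars X + j)"
proof -
  let ?n = "nvars X" and ?n' = "nvars X'" and ?m = "nvars Y"
  let ?W = "var_prod X Y" and ?W' = "var_prod X' Y"
  have W: "?W \<in> CV" and W': "?W' \<in> CV" using var_prod_CV X X' Y by auto
  have simps [simp]: "nvars ?W = ?n + ?m" "eqs ?W = eqs X \<union> rename (\<lambda>j. ?n + j) ` eqs Y"
    "ineqs ?W = ineqs X \<union> rename (\<lambda>j. ?n + j) ` ineqs Y"
    "nvars ?W' = ?n' + ?m" "eqs ?W' = eqs X' \<union> rename (\<lambda>j. ?n' + j) ` eqs Y"
    "ineqs ?W' = ineqs X' \<union> rename (\<lambda>j. ?n' + j) ` ineqs Y"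
    by (simp_all add: var_prod_def)
  obtain a where a: "morphism ?W X a" "\<And>i. i < ?n \<Longrightarrow> a i = rvar i"
    by (rule morphism_extend[OF W X, of rvar])
      (auto intro!: eqs_in_coord_ideal[OF W] ineqs_unit_on[OF W])
  define F\<^sub>0 where "F\<^sub>0 k = (if k < ?n' then subst a (f k) else rvar (?n + (k - ?n')))" for k
  have F1: "subst F\<^sub>0 p = subst a (subst f p)" if "p \<in> Rpoly ?n'" for p
    unfolding subst_subst by (rule subst_cong[OF that]) (simp add: F\<^sub>0_def)
  have F2: "subst F\<^sub>0 (rename (\<lambda>j. ?n' + j) p) = rename (\<lambda>j. ?n + j) p" for p
    unfolding rename_eq_subst subst_subst by (simp add: F\<^sub>0_def)
  note R = subsetD[OF CVD(3)[OF X']] subsetD[OF CVD(4)[OF X']]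
  obtain F where F: "morphism ?W ?W' F" "\<And>k. k < nvars ?W' \<Longrightarrow> F k = F\<^sub>0 k"
  proof (rule morphism_extend[OF W W', of F\<^sub>0])
    fix k assume "k < nvars ?W'"
    moreover have "f k \<in> Rpoly (Suc ?n)" if "k < ?n'" using f that by (simp add: morphism_def)
    ultimately show "F\<^sub>0 k \<in> Rpoly (Suc (nvars ?W))"
      using morphism_subst_closed[OF a(1)] by (auto simp: F\<^sub>0_def)
  next
    fix p assume "p \<in> eqs ?W'"
    then consider "p \<in> eqs X'" | p' where "p = rename (\<lambda>j. ?n' + j) p'" "p' \<in> eqs Y" by auto
    then show "subst F\<^sub>0 p \<in> coord_ideal ?W"
    proof cases
      case 1
      then show ?thesis
        using morphism_coord_ideal[OF W X a(1) morphism_coord_ideal[OF X X' f]] eqs_in_coord_ideal[OF X']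
        by (simp add: F1[OF R(1)])
    next
      case 2
      then show ?thesis by (auto simp: F2 intro!: eqs_in_coord_ideal[OF W])
    qed
  next
    fix q assume "q \<in> ineqs ?W'"
    then consider "q \<in> ineqs X'" | q' where "q = rename (\<lambda>j. ?n' + j) q'" "q' \<in> ineqs Y" by auto
    then show "unit_on ?W (subst F\<^sub>0 q)"
    proof cases
      case 1
      then show ?thesis
        using morphism_unit_on[OF W X a(1) morphism_unit_on[OF X X' f]] ineqs_unit_on[OF X']
        by (simp add: F1[OF R(2)])
    next
      case 2
      then show ?thesis by (auto simp: F2 intro!: ineqs_unit_on[OF W])
    qed
  qed blast
  show thesis
    by (rule that[OF a F(1)]) (simp_all add: F(2) F\<^sub>0_def)
qed

text \<open>Both \<open>X \<times> Y \<rightarrow> X' \<times> Y \<rightarrow> X'\<close> and \<open>X \<times> Y \<rightarrow> X \<rightarrow> X'\<close> have the same coordinates. By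
  uniqueness they agree on all polynomials, also on \<open>g k\<close>, which may contain the auxiliary variable.\<close>

lemma var_prod_iso_half:
  assumes X: "X \<in> CV" and X': "X' \<in> CV" and Y: "Y \<in> CV"
    and f: "morphism X X' f" and g: "morphism X' X g" and fg: "inverse_on X f g"
    and a: "morphism (var_prod X Y) X a" "\<And>i. i < nvars X \<Longrightarrow> a i = rvar i"
    and F: "morphism (var_prod X Y) (var_prod X' Y) F"
      "\<And>i. i < nvars X' \<Longrightarrow> F i = subst a (f i)"
      "\<And>j. j < nvars Y \<Longrightarrow> F (nvars X' + j) = rvar (nvars X + j)"
    and b: "morphism (var_prod X' Y) X' b" "\<And>i. i < nvars X' \<Longrightarrow> b i = rvar i"
    and G: "\<And>i. i < nvars X \<Longrightarrow> G i = subst b (g i)"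
      "\<And>j. j < nvars Y \<Longrightarrow> G (nvars X + j) = rvar (nvars X' + j)"
  shows "inverse_on (var_prod X Y) F G"
  unfolding inverse_on_def
proof (intro allI impI)
  let ?W = "var_prod X Y" and ?W' = "var_prod X' Y"
  have W: "?W \<in> CV" and W': "?W' \<in> CV" using var_prod_CV X X' Y by auto
  note I = coord_ideal_closed[OF W]
  fix k assume "k < nvars ?W"
  then consider "k < nvars X" | j where "k = nvars X + j" "j < nvars Y"
    by (metis join_simps(1) var_prod_def add_diff_inverse_nat nat_add_left_cancel_less)
  then show "subst F (G k) - rvar k \<in> coord_ideal ?W"
  proof cases
    case 1
    have gk: "g k \<in> Rpoly (Suc (nvars X'))" using g 1 by (simp add: morphism_def)
    have "subst (\<lambda>i. subst F (b i)) (g k) - subst (\<lambda>i. subst a (f i)) (g k) \<in> coord_ideal ?W"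
      using I(2)
      by (intro morphism_unique[OF W X' morphism_comp[OF W W' X' F(1) b(1)]
            morphism_comp[OF W X X' a(1) f] _ gk]) (simp add: F(2) b(2))
    then have "subst F (G k) - subst a (subst f (g k)) \<in> coord_ideal ?W"
      by (simp add: G(1)[OF 1] subst_subst)
    moreover have "subst a (subst f (g k) - rvar k) \<in> coord_ideal ?W"
      using fg 1 by (intro morphism_coord_ideal[OF W X a(1)]) (simp add: inverse_on_def)
    ultimately have "(subst F (G k) - subst a (subst f (g k))) + subst a (subst f (g k) - rvar k) \<in> coord_ideal ?W"
      by (rule I(3))
    then show ?thesis by (simp add: a(2)[OF 1])
  next
    case 2
    then show ?thesis using I(2) by (simp add: G(2) F(3))
  qed
qed

lemma var_prod_iso:
  assumes X: "X \<in> CV" and X': "X' \<in> CV" and Y: "Y \<in> CV" and iso: "iso_over_real X X'"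
  shows "iso_over_real (var_prod X Y) (var_prod X' Y)"
proof -
  obtain f g where f: "morphism X X' f" and g: "morphism X' X g"
    and fg: "inverse_on X f g" and gf: "inverse_on X' g f"
    using iso_over_realE[OF X X' iso] .
  obtain a F where F: "morphism (var_prod X Y) X a" "\<And>i. i < nvars X \<Longrightarrow> a i = rvar i"
    "morphism (var_prod X Y) (var_prod X' Y) F"
    "\<And>i. i < nvars X' \<Longrightarrow> F i = subst a (f i)"
    "\<And>j. j < nvars Y \<Longrightarrow> F (nvars X' + j) = rvar (nvars X + j)"
    using var_prod_morphism[OF X X' Y f] by metis
  obtain b G where G: "morphism (var_prod X' Y) X' b" "\<And>i. i < nvars X' \<Longrightarrow> b i = rvar i"
    "morphism (var_prod X' Y) (var_prod X Y) G"
    "\<And>i. i < nvars X \<Longrightarrow> G i = subst b (g i)"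
    "\<And>j. j < nvars Y \<Longrightarrow> G (nvars X + j) = rvar (nvars X' + j)"
    using var_prod_morphism[OF X' X Y g] by metis
  show ?thesis
    by (intro iso_over_realI[OF _ _ F(3) G(3)] var_prod_CV X X' Y
        var_prod_iso_half[OF X X' Y f g fg F G(1,2,4,5)]
        var_prod_iso_half[OF X' X Y g f gf G F(1,2,4,5)])
qed

section \<open>Loci\<close>

definition contraction :: "(nat \<Rightarrow> nat) \<Rightarrow> nat \<Rightarrow> rpoly set \<Rightarrow> rpoly set" where
  "contraction \<sigma> n P = {p \<in> Rpoly n. rename \<sigma> p \<in> P}"

text \<open>A prime ideal of a product lies over the two factors through its contractions. With this
  description, closed subvarieties and complements are visibly stable under products.\<close>

lemma locus_join:
  assumes X: "X \<in> CV" and Y: "Y \<in> CV" and c: "complementary (nvars X) \<sigma> (nvars Y) \<tau>"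
  shows "locus (join \<sigma> X \<tau> Y) = {P. primeideal P (rpoly_ring (nvars X + nvars Y)) \<and>
    contraction \<sigma> (nvars X) P \<in> locus X \<and> contraction \<tau> (nvars Y) P \<in> locus Y}"
proof -
  have "primeideal (contraction \<sigma> (nvars X) P) (rpoly_ring (nvars X))"
    "primeideal (contraction \<tau> (nvars Y) P) (rpoly_ring (nvars Y))"
    if "primeideal P (rpoly_ring (nvars X + nvars Y))" for P
    using subst_contraction_prime[OF that] complementary_less[OF c]
    by (auto simp: contraction_def rename_eq_subst)
  then show ?thesis
    using CVD(3,4)[OF X] CVD(3,4)[OF Y]
    by (auto simp: locus_def contraction_def subset_iff disjoint_iff)
qed

lemma closed_subvariety_var_prod:
  assumes X: "X \<in> CV" and Y: "Y \<in> CV" and W: "W \<in> CV" and cl: "closed_subvariety Y X"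
  shows "closed_subvariety (var_prod Y W) (var_prod X W)"
proof -
  obtain S where S: "finite S" "S \<subseteq> Rpoly (nvars X)" "locus Y = {P \<in> locus X. S \<subseteq> P}"
    and n: "nvars Y = nvars X"
    using cl by (auto simp: closed_subvariety_def)
  have "locus (var_prod Y W) = {P \<in> locus (var_prod X W). S \<subseteq> P}"
    using S(2) unfolding var_prod_def
    by (auto simp: locus_join[OF Y W] locus_join[OF X W] complementary_shift S(3) n contraction_def)
  moreover have "S \<subseteq> Rpoly (nvars X + nvars W)"
    using S(2) Rpoly_mono[of "nvars X" "nvars X + nvars W"] by auto
  ultimately show ?thesis
    using S(1) n unfolding closed_subvariety_def by (auto simp: var_prod_def)
qed

lemma is_complement_var_prod:
  assumes X: "X \<in> CV" and Y: "Y \<in> CV" and Z: "Z \<in> CV" and W: "W \<in> CV"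
    and n: "nvars Y = nvars X" and comp: "is_complement Z X Y"
  shows "is_complement (var_prod Z W) (var_prod X W) (var_prod Y W)"
  using comp unfolding is_complement_def var_prod_def
  by (auto simp: locus_join[OF X W] locus_join[OF Y W] locus_join[OF Z W] complementary_shift n)

lemma with_simps [simp]:
  "nvars (with_eq A S) = nvars A" "eqs (with_eq A S) = insert S (eqs A)"
  "ineqs (with_eq A S) = ineqs A" "pos (with_eq A S) = pos A"
  "nvars (with_ineq A S) = nvars A" "eqs (with_ineq A S) = eqs A"
  "ineqs (with_ineq A S) = insert S (ineqs A)" "pos (with_ineq A S) = pos A"
  "nvars (with_pos A S) = nvars A" "eqs (with_pos A S) = eqs A"
  "ineqs (with_pos A S) = ineqs A" "pos (with_pos A S) = insert S (pos A)"
  by (simp_all add: with_eq_def with_ineq_def with_pos_def)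

lemma with_bsa_formulas:
  assumes "A \<in> bsa_formulas" "S \<in> Rpoly (nvars A)"
  shows "with_eq A S \<in> bsa_formulas" "with_ineq A S \<in> bsa_formulas" "with_pos A S \<in> bsa_formulas"
  using assms by (auto simp: bsa_formulas_def)

lemma with_CV:
  assumes "A \<in> CV" "S \<in> Rpoly (nvars A)"
  shows "with_eq A S \<in> CV" "with_ineq A S \<in> CV"
  using assms by (auto simp: constructible_varieties_def with_bsa_formulas)

lemma locus_with_eq: "locus (with_eq A S) = {P \<in> locus A. S \<in> P}"
  and locus_with_ineq: "locus (with_ineq A S) = {P \<in> locus A. S \<notin> P}"
  by (auto simp: locus_def)

section \<open>The Grothendieck ring of varieties\<close>

lemma frag_induct [case_names of diff]:
  assumes "Poly_Mapping.keys x \<subseteq> S" "\<And>a. a \<in> S \<Longrightarrow> P (frag_of a)" "\<And>a b. P a \<Longrightarrow> P b \<Longrightarrow> P (a - b)" "P 0"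
  shows "P x"
  using assms(1,4,2,3) by (rule frag_induction)

definition vmul :: "(bsa_formula \<Rightarrow>\<^sub>0 int) \<Rightarrow> (bsa_formula \<Rightarrow>\<^sub>0 int) \<Rightarrow> (bsa_formula \<Rightarrow>\<^sub>0 int)" where
  "vmul x y = frag_extend (\<lambda>X. frag_extend (\<lambda>Y. frag_of (var_prod X Y)) y) x"

abbreviation VF :: "(bsa_formula \<Rightarrow>\<^sub>0 int) set" where "VF \<equiv> carrier var_free"

lemma var_free_simps [simp]:
  "mult var_free = vmul" "one var_free = frag_of empty_formula" "zero var_free = 0" "add var_free = (+)"
  by (auto simp: var_free_def vmul_def fun_eq_iff)

lemma VF_iff: "x \<in> VF \<longleftrightarrow> Poly_Mapping.keys x \<subseteq> CV"
  by (simp add: var_free_def)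

lemma vmul_of [simp]: "vmul (frag_of X) (frag_of Y) = frag_of (var_prod X Y)"
  by (simp add: vmul_def)

lemma vmul_left [simp]:
  "vmul 0 y = 0" "vmul (x + x') y = vmul x y + vmul x' y" "vmul (x - x') y = vmul x y - vmul x' y"
  by (simp_all add: vmul_def frag_extend_add frag_extend_diff)

lemma vmul_right_diff [simp]: "vmul x (y - y') = vmul x y - vmul x y'"
proof (rule frag_induct[of x UNIV])
  show "vmul (frag_of X) (y - y') = vmul (frag_of X) y - vmul (frag_of X) y'" for X
    by (simp add: vmul_def frag_extend_diff)
qed simp_all

lemma vmul_right [simp]: "vmul x 0 = 0" "vmul x (y + y') = vmul x y + vmul x y'"
  using vmul_right_diff[of x 0 0] vmul_right_diff[of x "y + y'" y'] by (auto simp: algebra_simps)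

lemma bsa_formula_eqI:
  "nvars A = nvars B \<Longrightarrow> eqs A = eqs B \<Longrightarrow> ineqs A = ineqs B \<Longrightarrow> pos A = pos B \<Longrightarrow> A = B"
  by (rule bsa_formula.expand) simp

lemma var_prod_assoc: "var_prod (var_prod X Y) Z = var_prod X (var_prod Y Z)"
  by (rule bsa_formula_eqI)
    (simp_all add: var_prod_def image_Un image_image rename_rename comp_def add.assoc Un_assoc)

lemma rename_ident [simp]: "rename (\<lambda>j. j) p = p"
  using rename_id[of p] by (simp add: id_def)

lemma var_prod_empty [simp]: "var_prod empty_formula X = X" "var_prod X empty_formula = X"
  by (rule bsa_formula_eqI; simp add: var_prod_def empty_formula_def)+

lemma vmul_assoc: "vmul (vmul x y) z = vmul x (vmul y z)"
proof (rule frag_induct[of x UNIV])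
  fix X
  show "vmul (vmul (frag_of X) y) z = vmul (frag_of X) (vmul y z)"
  proof (rule frag_induct[of y UNIV])
    fix Y
    show "vmul (vmul (frag_of X) (frag_of Y)) z = vmul (frag_of X) (vmul (frag_of Y) z)"
      by (rule frag_induct[of z UNIV]) (simp_all add: var_prod_assoc)
  qed simp_all
qed simp_all

lemma vmul_one [simp]: "vmul (frag_of empty_formula) x = x" "vmul x (frag_of empty_formula) = x"
  by (rule frag_induct[of x UNIV]; simp)+

lemma VF_closed [simp]:
  "0 \<in> VF" "x \<in> VF \<Longrightarrow> y \<in> VF \<Longrightarrow> x + y \<in> VF" "x \<in> VF \<Longrightarrow> y \<in> VF \<Longrightarrow> x - y \<in> VF"
  "x \<in> VF \<Longrightarrow> - x \<in> VF" "frag_of X \<in> VF \<longleftrightarrow> X \<in> CV"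
  using keys_add[of x y] keys_diff[of x y] by (auto simp: VF_iff)

lemma VF_induct [consumes 1, case_names of diff zero]:
  assumes "x \<in> VF" "\<And>X. X \<in> CV \<Longrightarrow> P (frag_of X)"
    "\<And>a b. P a \<Longrightarrow> P b \<Longrightarrow> P (a - b)" "P 0"
  shows "P x"
  by (rule frag_induct[of x CV]) (use assms in \<open>auto simp: VF_iff\<close>)

lemma vmul_closed [simp]: "x \<in> VF \<Longrightarrow> y \<in> VF \<Longrightarrow> vmul x y \<in> VF"
proof (induction x rule: VF_induct)
  case (of X)
  from \<open>y \<in> VF\<close> show ?case
    by (induction y rule: VF_induct) (simp_all add: var_prod_CV of)
qed simp_all

lemma empty_formula_CV [simp]: "empty_formula \<in> CV"
  by (simp add: constructible_varieties_def bsa_formulas_def empty_formula_def)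

lemma var_free_ring: "ring var_free"
proof (rule ringI)
  show "abelian_group var_free"
  proof (rule abelian_groupI, goal_cases)
    case (6 x)
    then show ?case by (intro bexI[of _ "- x"]) simp_all
  qed (simp_all add: add.assoc add.commute)
  show "Group.monoid var_free"
    by (rule monoidI) (simp_all add: vmul_assoc)
qed simp_all

interpretation vf: ring var_free by (rule var_free_ring)

lemma var_free_a_inv: "x \<in> VF \<Longrightarrow> \<ominus>\<^bsub>var_free\<^esub> x = - x"
  using vf.minus_equality[of "- x" x] by simp

lemma var_subgroupI:
  assumes "0 \<in> H" "\<And>a b. a \<in> H \<Longrightarrow> b \<in> H \<Longrightarrow> a - b \<in> H" "H \<subseteq> VF"
  shows "subgroup H (add_monoid var_free)"
proof -
  have neg: "- a \<in> H" if "a \<in> H" for a using assms(2)[OF assms(1) that] by simp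
  show ?thesis
  proof (rule vf.add.subgroupI)
    show "H \<noteq> {}" "H \<subseteq> VF" using assms by auto
    show "\<ominus>\<^bsub>var_free\<^esub> a \<in> H" if "a \<in> H" for a
      using that neg assms(3) by (subst var_free_a_inv) auto
    show "a \<oplus>\<^bsub>var_free\<^esub> b \<in> H" if "a \<in> H" "b \<in> H" for a b
      using assms(2)[OF that(1) neg[OF that(2)]] by simp
  qed
qed

lemma var_relations_closed: "var_relations \<subseteq> VF"
  unfolding var_relations_def by (intro Un_least subsetI; elim CollectE exE conjE; simp)

lemma var_subgroup_subgroup: "subgroup var_subgroup (add_monoid var_free)"
  unfolding var_subgroup_def
  by (rule vf.add.generate_is_subgroup) (simp add: var_relations_closed)

lemma var_subgroup_closed:
  "var_subgroup \<subseteq> VF" "0 \<in> var_subgroup"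
  "a \<in> var_subgroup \<Longrightarrow> b \<in> var_subgroup \<Longrightarrow> a + b \<in> var_subgroup"
  "a \<in> var_subgroup \<Longrightarrow> b \<in> var_subgroup \<Longrightarrow> a - b \<in> var_subgroup"
proof -
  interpret subgroup var_subgroup "add_monoid var_free" by (rule var_subgroup_subgroup)
  show *: "var_subgroup \<subseteq> VF" "0 \<in> var_subgroup"
    "\<And>a b. a \<in> var_subgroup \<Longrightarrow> b \<in> var_subgroup \<Longrightarrow> a + b \<in> var_subgroup"
    using subset one_closed m_closed by auto
  show "a - b \<in> var_subgroup" if "a \<in> var_subgroup" "b \<in> var_subgroup"
  proof -
    have "\<ominus>\<^bsub>var_free\<^esub> b \<in> var_subgroup"
      unfolding a_inv_def by (rule m_inv_closed[OF that(2)])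
    then have "- b \<in> var_subgroup"
      unfolding var_free_a_inv[OF subsetD[OF *(1) that(2)]] .
    from *(3)[OF that(1) this] show ?thesis by simp
  qed
qed

lemma var_subgroup_least:
  assumes "0 \<in> H" "\<And>a b. a \<in> H \<Longrightarrow> b \<in> H \<Longrightarrow> a - b \<in> H" "H \<subseteq> VF" "var_relations \<subseteq> H"
  shows "var_subgroup \<subseteq> H"
  unfolding var_subgroup_def
  by (rule vf.add.generate_subgroup_incl[OF assms(4) var_subgroupI[OF assms(1-3)]])

lemma var_subgroup_iso:
  assumes "X \<in> CV" "Y \<in> CV" "iso_over_real X Y"
  shows "frag_of X - frag_of Y \<in> var_subgroup"
  unfolding var_subgroup_def var_relations_def
  by (intro generate.incl UnI1 CollectI exI[of _ X] exI[of _ Y] conjI refl assms)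

lemma var_subgroup_scissor:
  assumes "X \<in> CV" "Y \<in> CV" "Z \<in> CV" "closed_subvariety Y X" "is_complement Z X Y"
  shows "frag_of X - (frag_of Y + frag_of Z) \<in> var_subgroup"
  unfolding var_subgroup_def var_relations_def
  by (intro generate.incl UnI2 CollectI exI[of _ X] exI[of _ Y] exI[of _ Z] conjI refl assms)

text \<open>The empty variety is closed in itself with empty complement, so that its class is twice itself.\<close>

lemma var_subgroup_empty_locus:
  assumes X: "X \<in> CV" and "locus X = {}"
  shows "frag_of X \<in> var_subgroup"
proof -
  have "closed_subvariety X X"
    unfolding closed_subvariety_def by (intro conjI exI[of _ "{}"]) simp_all
  moreover have "is_complement X X X"
    using assms by (simp add: is_complement_def)
  ultimately have sc: "frag_of X - (frag_of X + frag_of X) \<in> var_subgroup"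
    by (intro var_subgroup_scissor X)
  from var_subgroup_closed(4)[OF var_subgroup_closed(2) sc]
  have "0 - (frag_of X - (frag_of X + frag_of X)) \<in> var_subgroup" .
  then show ?thesis by simp
qed

text \<open>The relations are only divided out additively; they form an ideal because isomorphisms, closed
  subvarieties and complements are stable under products with a fixed variety.\<close>

lemma var_subgroup_mult_right:
  assumes x: "x \<in> var_subgroup" and y: "y \<in> VF"
  shows "vmul x y \<in> var_subgroup"
  using y
proof (induction y rule: VF_induct)
  case (of W)
  let ?H = "{x \<in> VF. vmul x (frag_of W) \<in> var_subgroup}"
  have "r \<in> ?H" if "r \<in> var_relations" for r
    using that unfolding var_relations_def
  proof (elim UnE CollectE exE conjE)
    fix X Y assume "r = frag_of X - frag_of Y" "X \<in> CV" "Y \<in> CV" "iso_over_real X Y"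
    then show ?thesis using of by (simp add: var_subgroup_iso var_prod_CV var_prod_iso)
  next
    fix X Y Z assume r: "r = frag_of X - (frag_of Y + frag_of Z)" and CV: "X \<in> CV" "Y \<in> CV" "Z \<in> CV"
      and cl: "closed_subvariety Y X" "is_complement Z X Y"
    have "nvars Y = nvars X" using cl(1) by (simp add: closed_subvariety_def)
    then show ?thesis using r CV cl of
      by (simp add: var_subgroup_scissor var_prod_CV closed_subvariety_var_prod is_complement_var_prod)
  qed
  then have "var_subgroup \<subseteq> ?H"
    by (intro var_subgroup_least) (auto intro: var_subgroup_closed)
  then show ?case using x by blast
qed (simp_all add: var_subgroup_closed)

lemma var_subgroup_commute:
  assumes "x \<in> VF" "y \<in> VF"
  shows "vmul x y - vmul y x \<in> var_subgroup"
  using assms(1)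
proof (induction x rule: VF_induct)
  case (of X)
  from assms(2) show ?case
  proof (induction y rule: VF_induct)
    case Y: (of Y)
    then show ?case
      using of by (simp add: var_subgroup_iso var_prod_CV var_prod_commute_iso)
  next
    case (diff a b)
    from var_subgroup_closed(4)[OF this] show ?case by (simp add: algebra_simps)
  qed (simp add: var_subgroup_closed)
next
  case (diff a b)
  from var_subgroup_closed(4)[OF this] show ?case by (simp add: algebra_simps)
qed (simp add: var_subgroup_closed)

lemma var_subgroup_mult_left:
  assumes x: "x \<in> var_subgroup" and y: "y \<in> VF"
  shows "vmul y x \<in> var_subgroup"
proof -
  have "x \<in> VF" using x var_subgroup_closed(1) by (rule subsetD[rotated])
  then have "(vmul y x - vmul x y) + vmul x y \<in> var_subgroup"
    by (intro var_subgroup_closed(3) var_subgroup_commute var_subgroup_mult_right x y)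
  then show ?thesis by simp
qed

section \<open>The Grothendieck ring of basic semialgebraic formulas\<close>

lemma bsa_free_simps [simp]:
  "mult bsa_free = (*)" "one bsa_free = 1" "zero bsa_free = 0" "add bsa_free = (+)"
  by (simp_all add: bsa_free_def)

abbreviation BF :: "(bsa_formula multiset \<Rightarrow>\<^sub>0 int) set" where "BF \<equiv> carrier bsa_free"

lemma BF_closed [simp]:
  "0 \<in> BF" "1 \<in> BF" "x \<in> BF \<Longrightarrow> y \<in> BF \<Longrightarrow> x + y \<in> BF" "x \<in> BF \<Longrightarrow> y \<in> BF \<Longrightarrow> x - y \<in> BF"
  "x \<in> BF \<Longrightarrow> y \<in> BF \<Longrightarrow> x * y \<in> BF" "A \<in> bsa_formulas \<Longrightarrow> bsa_symbol A \<in> BF"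
  by (auto simp: bsa_free_def bsa_symbol_def mpoly_carrier_single)

lemma bsa_free_cring: "cring bsa_free"
  unfolding bsa_free_def by (rule mpoly_ring_cring)

interpretation bf: cring bsa_free by (rule bsa_free_cring)

lemma strict_mono_on_complementary:
  assumes "strict_mono_on {..<n} \<sigma>" "strict_mono_on {..<m} \<tau>"
    "\<sigma> ` {..<n} \<inter> \<tau> ` {..<m} = {}" "\<sigma> ` {..<n} \<union> \<tau> ` {..<m} = {..<n + m}"
  shows "complementary n \<sigma> m \<tau>"
  using assms strict_mono_on_imp_inj_on unfolding complementary_def by blast

lemma empty_formula_bsa [simp]: "empty_formula \<in> bsa_formulas"
  using CVD(1)[OF empty_formula_CV] .

lemma bsa_relations_closed: "bsa_relations \<subseteq> BF"
proof
  fix r assume "r \<in> bsa_relations"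
  then show "r \<in> BF"
    unfolding bsa_relations_def
    by (elim UnE CollectE exE conjE)
      (simp_all add: with_bsa_formulas join_bsa_formulas strict_mono_on_complementary)
qed

lemma bsa_ideal_ideal: "ideal bsa_ideal bsa_free"
  unfolding bsa_ideal_def by (rule bf.genideal_ideal[OF bsa_relations_closed])

lemma bsa_relations_in_ideal: "r \<in> bsa_relations \<Longrightarrow> r \<in> bsa_ideal"
  unfolding bsa_ideal_def using bf.genideal_self[OF bsa_relations_closed] by blast

lemma bsa_ideal_closed:
  "bsa_ideal \<subseteq> BF" "0 \<in> bsa_ideal"
  "a \<in> bsa_ideal \<Longrightarrow> b \<in> bsa_ideal \<Longrightarrow> a + b \<in> bsa_ideal"
  "a \<in> bsa_ideal \<Longrightarrow> b \<in> bsa_ideal \<Longrightarrow> a - b \<in> bsa_ideal"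
  "a \<in> bsa_ideal \<Longrightarrow> x \<in> BF \<Longrightarrow> x * a \<in> bsa_ideal"
proof -
  show *: "bsa_ideal \<subseteq> BF" "0 \<in> bsa_ideal"
    "\<And>a b. a \<in> bsa_ideal \<Longrightarrow> b \<in> bsa_ideal \<Longrightarrow> a + b \<in> bsa_ideal"
    "\<And>a x. a \<in> bsa_ideal \<Longrightarrow> x \<in> BF \<Longrightarrow> x * a \<in> bsa_ideal"
    using bsa_ideal_ideal unfolding bsa_free_def mpoly_ideal_iff by auto
  show "a - b \<in> bsa_ideal" if "a \<in> bsa_ideal" "b \<in> bsa_ideal"
    using *(3)[OF that(1) *(4)[OF that(2), of "0 - 1"]] BF_closed(4)[OF BF_closed(1,2)] by simp
qed

lemma bsa_ideal_iso:
  assumes "X \<in> CV" "Y \<in> CV" "iso_over_real X Y"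
  shows "bsa_symbol X - bsa_symbol Y \<in> bsa_ideal"
  by (rule bsa_relations_in_ideal, unfold bsa_relations_def,
      rule UnI1, rule UnI1, rule UnI1, rule UnI1, rule CollectI,
      intro exI[of _ X] exI[of _ Y] conjI refl CVD(1,2) assms)

lemma bsa_ideal_split:
  assumes "A \<in> bsa_formulas" "S \<in> Rpoly (nvars A)"
  shows "bsa_symbol A - (bsa_symbol (with_eq A S) + bsa_symbol (with_ineq A S)) \<in> bsa_ideal"
  by (rule bsa_relations_in_ideal, unfold bsa_relations_def,
      rule UnI1, rule UnI1, rule UnI1, rule UnI2, rule CollectI,
      intro exI[of _ A] exI[of _ S] conjI refl assms)

lemma bsa_ideal_same_locus:
  "X \<in> CV \<Longrightarrow> Y \<in> CV \<Longrightarrow> nvars X = nvars Y \<Longrightarrow> locus X = locus Y \<Longrightarrow>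
    bsa_symbol X - bsa_symbol Y \<in> bsa_ideal"
  by (intro bsa_ideal_iso same_locus_iso)

text \<open>Splitting \<open>X\<close> by the polynomial \<open>1\<close> gives two varieties that are again empty, so isomorphic to \<open>X\<close>.\<close>

lemma bsa_ideal_empty_locus:
  assumes X: "X \<in> CV" and empty: "locus X = {}"
  shows "bsa_symbol X \<in> bsa_ideal"
proof -
  have XS: "with_eq X 1 \<in> CV" "with_ineq X 1 \<in> CV" using with_CV[OF X] by auto
  have "bsa_symbol X - (bsa_symbol (with_eq X 1) + bsa_symbol (with_ineq X 1)) \<in> bsa_ideal"
    using bsa_ideal_split CVD(1)[OF X] by simp
  moreover have "bsa_symbol X - bsa_symbol (with_eq X 1) \<in> bsa_ideal"
    by (rule bsa_ideal_same_locus[OF X XS(1)]) (simp_all add: empty locus_with_eq)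
  moreover have "bsa_symbol X - bsa_symbol (with_ineq X 1) \<in> bsa_ideal"
    by (rule bsa_ideal_same_locus[OF X XS(2)]) (simp_all add: empty locus_with_ineq)
  ultimately have "(bsa_symbol X - bsa_symbol (with_eq X 1)) + (bsa_symbol X - bsa_symbol (with_ineq X 1)) -
      (bsa_symbol X - (bsa_symbol (with_eq X 1) + bsa_symbol (with_ineq X 1))) \<in> bsa_ideal"
    by - (assumption | rule bsa_ideal_closed(3,4))+
  then show ?thesis by (simp add: algebra_simps)
qed

text \<open>Splitting \<open>X\<close> by one polynomial of \<open>S\<close> after the other gives \<open>Y\<close> and a decomposition of the complement;
  splitting \<open>Z\<close> in the same way gives pieces with the same loci, and the locus determines a variety up to
  isomorphism.\<close>

lemma bsa_ideal_scissor:
  assumes "finite S" "S \<subseteq> Rpoly (nvars X)" "X \<in> CV" "Y \<in> CV" "Z \<in> CV"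
    "nvars Y = nvars X" "nvars Z = nvars X"
    "locus Y = {P \<in> locus X. S \<subseteq> P}" "locus Z = {P \<in> locus X. \<not> S \<subseteq> P}"
  shows "bsa_symbol X - (bsa_symbol Y + bsa_symbol Z) \<in> bsa_ideal"
  using assms
proof (induction S arbitrary: X Z rule: finite_induct)
  case empty
  then have "bsa_symbol X - bsa_symbol Y \<in> bsa_ideal" "bsa_symbol Z \<in> bsa_ideal"
    by (simp_all add: bsa_ideal_same_locus bsa_ideal_empty_locus)
  then have "(bsa_symbol X - bsa_symbol Y) - bsa_symbol Z \<in> bsa_ideal"
    by (rule bsa_ideal_closed(4))
  then show ?case by (simp add: algebra_simps)
next
  case (insert s S)
  let ?X1 = "with_eq X s" and ?X2 = "with_ineq X s" and ?Z1 = "with_eq Z s" and ?Z2 = "with_ineq Z s"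
  have s: "s \<in> Rpoly (nvars X)" "s \<in> Rpoly (nvars Z)" using insert.prems by auto
  have CV: "?X1 \<in> CV" "?X2 \<in> CV" "?Z1 \<in> CV" "?Z2 \<in> CV" using with_CV s insert.prems by auto
  have "bsa_symbol ?X1 - (bsa_symbol Y + bsa_symbol ?Z1) \<in> bsa_ideal"
    by (rule insert.IH) (use insert.prems CV in \<open>auto simp: locus_with_eq\<close>)
  moreover have "bsa_symbol ?X2 - bsa_symbol ?Z2 \<in> bsa_ideal"
    by (rule bsa_ideal_same_locus) (use insert.prems CV in \<open>auto simp: locus_with_ineq\<close>)
  moreover have "bsa_symbol X - (bsa_symbol ?X1 + bsa_symbol ?X2) \<in> bsa_ideal"
    "bsa_symbol Z - (bsa_symbol ?Z1 + bsa_symbol ?Z2) \<in> bsa_ideal"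
    using bsa_ideal_split s CVD(1) insert.prems by auto
  ultimately have "((bsa_symbol X - (bsa_symbol ?X1 + bsa_symbol ?X2)) + (bsa_symbol ?X1 - (bsa_symbol Y + bsa_symbol ?Z1))) +
      ((bsa_symbol ?X2 - bsa_symbol ?Z2) - (bsa_symbol Z - (bsa_symbol ?Z1 + bsa_symbol ?Z2))) \<in> bsa_ideal"
    by - (assumption | rule bsa_ideal_closed(3,4))+
  then show ?case by (simp add: algebra_simps)
qed

section \<open>The natural map\<close>

abbreviation symbol_extend :: "(bsa_formula \<Rightarrow>\<^sub>0 int) \<Rightarrow> (bsa_formula multiset \<Rightarrow>\<^sub>0 int)" where
  "symbol_extend \<equiv> frag_extend bsa_symbol"

lemma symbol_extend_closed: "x \<in> VF \<Longrightarrow> symbol_extend x \<in> BF"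
  by (induction x rule: VF_induct) (simp_all add: frag_extend_diff CVD(1))

lemma bsa_ideal_var_prod:
  assumes "X \<in> CV" "Y \<in> CV"
  shows "bsa_symbol (var_prod X Y) - bsa_symbol X * bsa_symbol Y \<in> bsa_ideal"
proof -
  let ?\<tau> = "\<lambda>j. nvars X + j"
  have "strict_mono_on {..<nvars X} id" "strict_mono_on {..<nvars Y} ?\<tau>"
    by (auto simp: strict_mono_on_def)
  moreover have "id ` {..<nvars X} \<inter> ?\<tau> ` {..<nvars Y} = {}"
    "id ` {..<nvars X} \<union> ?\<tau> ` {..<nvars Y} = {..<nvars X + nvars Y}"
    using complementary_shift[of "nvars X" "nvars Y"] by (simp_all add: complementary_def)
  ultimately show ?thesis
    by - (rule bsa_relations_in_ideal, unfold bsa_relations_def var_prod_def,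
        rule UnI1, rule UnI2, rule CollectI,
        rule exI[of _ id], rule exI[of _ X], rule exI[of _ ?\<tau>], rule exI[of _ Y],
        intro conjI refl CVD(1) assms)
qed

lemma symbol_extend_mult:
  assumes "x \<in> VF" "y \<in> VF"
  shows "symbol_extend (vmul x y) - symbol_extend x * symbol_extend y \<in> bsa_ideal"
  using assms(1)
proof (induction x rule: VF_induct)
  case (of X)
  from assms(2) show ?case
  proof (induction y rule: VF_induct)
    case Y: (of Y)
    then show ?case using of by (simp add: bsa_ideal_var_prod)
  next
    case (diff a b)
    from bsa_ideal_closed(4)[OF this] show ?case by (simp add: algebra_simps frag_extend_diff)
  qed (simp add: bsa_ideal_closed)
next
  case (diff a b)
  from bsa_ideal_closed(4)[OF this] show ?case by (simp add: algebra_simps frag_extend_diff)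
qed (simp add: bsa_ideal_closed)

text \<open>The defining relations of varieties hold for formulas, so the natural map is well defined.\<close>

lemma symbol_extend_var_subgroup: "x \<in> var_subgroup \<Longrightarrow> symbol_extend x \<in> bsa_ideal"
proof -
  let ?H = "{x \<in> VF. symbol_extend x \<in> bsa_ideal}"
  have "r \<in> ?H" if rel: "r \<in> var_relations" for r
  proof -
    have "symbol_extend r \<in> bsa_ideal"
      using rel unfolding var_relations_def
    proof (elim UnE CollectE exE conjE)
      fix X Y assume "r = frag_of X - frag_of Y" "X \<in> CV" "Y \<in> CV" "iso_over_real X Y"
      then show ?thesis by (simp add: frag_extend_diff bsa_ideal_iso)
    next
      fix X Y Z assume r: "r = frag_of X - (frag_of Y + frag_of Z)" and CV: "X \<in> CV" "Y \<in> CV" "Z \<in> CV"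
        and cl: "closed_subvariety Y X" "is_complement Z X Y"
      obtain S where S: "finite S" "S \<subseteq> Rpoly (nvars X)" "locus Y = {P \<in> locus X. S \<subseteq> P}"
        and n: "nvars Y = nvars X" using cl(1) by (auto simp: closed_subvariety_def)
      have "nvars Z = nvars X" "locus Z = {P \<in> locus X. \<not> S \<subseteq> P}"
        using cl(2) S(3) by (auto simp: is_complement_def)
      then show ?thesis
        using bsa_ideal_scissor[OF S(1,2) CV n _ S(3)] by (simp add: r frag_extend_diff frag_extend_add)
    qed
    then show ?thesis using rel var_relations_closed by auto
  qed
  then have "var_subgroup \<subseteq> ?H"
    by (intro var_subgroup_least) (auto simp: bsa_ideal_closed frag_extend_diff)
  then show "symbol_extend x \<in> bsa_ideal" if "x \<in> var_subgroup" using that by auto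
qed

section \<open>The left inverse\<close>

definition leading_positive :: "bsa_formula \<Rightarrow> bool" where
  "leading_positive A \<longleftrightarrow> (\<forall>R \<in> pos A. lead_coeff_pos R)"

definition pos_to_ineq :: "bsa_formula \<Rightarrow> bsa_formula" where
  "pos_to_ineq A = Formula (nvars A) (eqs A) (ineqs A \<union> pos A) {}"

text \<open>The left inverse on a formula: every polynomial is declared to have everywhere the sign of its leading
  coefficient. An inequality \<open>R > 0\<close> then either becomes \<open>R \<noteq> 0\<close> or makes the formula empty.\<close>

definition sign_value :: "bsa_formula \<Rightarrow> (bsa_formula \<Rightarrow>\<^sub>0 int)" where
  "sign_value A = (if leading_positive A then frag_of (pos_to_ineq A) else 0)"

lemma pos_to_ineq_simps [simp]:
  "nvars (pos_to_ineq A) = nvars A" "eqs (pos_to_ineq A) = eqs A"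
  "ineqs (pos_to_ineq A) = ineqs A \<union> pos A" "pos (pos_to_ineq A) = {}"
  by (simp_all add: pos_to_ineq_def)

lemma pos_to_ineq_CV: "A \<in> bsa_formulas \<Longrightarrow> pos_to_ineq A \<in> CV"
  by (auto simp: constructible_varieties_def bsa_formulas_def)

lemma sign_value_closed: "A \<in> bsa_formulas \<Longrightarrow> sign_value A \<in> VF"
  by (simp add: sign_value_def pos_to_ineq_CV)

lemma sign_value_CV:
  assumes "X \<in> CV"
  shows "sign_value X = frag_of X"
proof -
  have "pos_to_ineq X = X" using CVD(2)[OF assms] by (intro bsa_formula_eqI) simp_all
  then show ?thesis using CVD(2)[OF assms] by (simp add: sign_value_def leading_positive_def)
qed

lemma leading_positive_with [simp]:
  "leading_positive (with_eq A S) \<longleftrightarrow> leading_positive A"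
  "leading_positive (with_ineq A S) \<longleftrightarrow> leading_positive A"
  "leading_positive (with_pos A S) \<longleftrightarrow> lead_coeff_pos S \<and> leading_positive A"
  by (simp_all add: leading_positive_def)

lemma pos_to_ineq_with:
  "pos_to_ineq (with_eq A S) = with_eq (pos_to_ineq A) S"
  "pos_to_ineq (with_ineq A S) = with_ineq (pos_to_ineq A) S"
  "pos_to_ineq (with_pos A S) = with_ineq (pos_to_ineq A) S"
  by (rule bsa_formula_eqI; simp)+

lemma sign_value_split:
  assumes A: "A \<in> bsa_formulas" and S: "S \<in> Rpoly (nvars A)"
  shows "sign_value A - (sign_value (with_eq A S) + sign_value (with_ineq A S)) \<in> var_subgroup"
proof (cases "leading_positive A")
  case True
  let ?X = "pos_to_ineq A"
  have CV: "?X \<in> CV" "with_eq ?X S \<in> CV" "with_ineq ?X S \<in> CV"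
    using pos_to_ineq_CV[OF A] with_CV[OF pos_to_ineq_CV[OF A]] S by simp_all
  have "closed_subvariety (with_eq ?X S) ?X"
    unfolding closed_subvariety_def
    by (intro conjI exI[of _ "{S}"]) (use S in \<open>auto simp: locus_with_eq\<close>)
  moreover have "is_complement (with_ineq ?X S) ?X (with_eq ?X S)"
    by (auto simp: is_complement_def locus_with_eq locus_with_ineq)
  ultimately have "frag_of ?X - (frag_of (with_eq ?X S) + frag_of (with_ineq ?X S)) \<in> var_subgroup"
    by (rule var_subgroup_scissor[OF CV])
  with True show ?thesis
    by (simp add: sign_value_def pos_to_ineq_with)
qed (simp add: sign_value_def var_subgroup_closed)

text \<open>For \<open>R \<noteq> 0\<close> exactly one of \<open>R\<close> and \<open>- R\<close> has a positive leading coefficient, and \<open>R \<noteq> 0\<close> and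
  \<open>- R \<noteq> 0\<close> have the same locus. For the zero polynomial no term survives on the right, and on the left is
  the class of an empty variety.\<close>

lemma sign_value_sign:
  assumes A: "A \<in> bsa_formulas" and R: "R \<in> Rpoly (nvars A)"
  shows "sign_value (with_ineq A R) - (sign_value (with_pos A R) + sign_value (with_pos A (- R)))
    \<in> var_subgroup"
proof (cases "leading_positive A")
  case True
  let ?X = "pos_to_ineq A"
  have X: "?X \<in> CV" by (rule pos_to_ineq_CV[OF A])
  have CV: "with_ineq ?X R \<in> CV" "with_ineq ?X (- R) \<in> CV" using with_CV[OF X] R by simp_all
  have ineq: "sign_value (with_ineq A R) = frag_of (with_ineq ?X R)"
    using True by (simp add: sign_value_def pos_to_ineq_with)
  have pos: "sign_value (with_pos A S) = (if lead_coeff_pos S then frag_of (with_ineq ?X S) else 0)" for S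
    using True by (simp add: sign_value_def pos_to_ineq_with)
  have ideals: "ideal P (rpoly_ring (nvars ?X))" if "P \<in> locus ?X" for P
    using that by (auto simp: locus_def intro: primeideal.axioms)
  consider "R = 0" | "R \<noteq> 0" "lead_coeff_pos R" | "R \<noteq> 0" "lead_coeff_pos (- R)" "\<not> lead_coeff_pos R"
    using lead_coeff_pos_uminus by blast
  then show ?thesis
  proof cases
    case 1
    have "locus (with_ineq ?X 0) = {}"
      using rpoly_ideal_closed(2)[OF ideals] by (auto simp: locus_with_ineq)
    then show ?thesis
      using var_subgroup_empty_locus[OF CV(1)] unfolding ineq pos by (simp add: 1)
  next
    case 2
    then show ?thesis
      unfolding ineq pos by (simp add: lead_coeff_pos_uminus var_subgroup_closed)
  next
    case 3
    have "- R \<in> P \<longleftrightarrow> R \<in> P" if "P \<in> locus ?X" for P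
      using rpoly_ideal_closed(2,4)[OF ideals[OF that]] by force
    then have "locus (with_ineq ?X R) = locus (with_ineq ?X (- R))"
      by (auto simp: locus_with_ineq)
    then have "iso_over_real (with_ineq ?X R) (with_ineq ?X (- R))"
      by (intro same_locus_iso CV) simp_all
    then show ?thesis
      unfolding ineq pos using 3 by (simp add: var_subgroup_iso CV)
  qed
qed (simp add: sign_value_def var_subgroup_closed)

text \<open>This is where the sign must be invariant under increasing renumberings of the variables.\<close>

lemma sign_value_join:
  assumes A: "A \<in> bsa_formulas" and B: "B \<in> bsa_formulas"
    and mono: "strict_mono_on {..<nvars A} \<sigma>" "strict_mono_on {..<nvars B} \<tau>"
    and c: "complementary (nvars A) \<sigma> (nvars B) \<tau>"
  shows "sign_value (join \<sigma> A \<tau> B) - vmul (sign_value A) (sign_value B) \<in> var_subgroup"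
proof -
  have "leading_positive (join \<sigma> A \<tau> B) \<longleftrightarrow> leading_positive A \<and> leading_positive B"
    using bsa_formulasD(3)[OF A] bsa_formulasD(3)[OF B]
    by (auto simp: leading_positive_def ball_Un lead_coeff_pos_rename[OF mono(1)]
        lead_coeff_pos_rename[OF mono(2)] subset_iff)
  moreover have "pos_to_ineq (join \<sigma> A \<tau> B) = join \<sigma> (pos_to_ineq A) \<tau> (pos_to_ineq B)"
    by (rule bsa_formula_eqI) auto
  moreover have "frag_of (join \<sigma> (pos_to_ineq A) \<tau> (pos_to_ineq B))
      - frag_of (var_prod (pos_to_ineq A) (pos_to_ineq B)) \<in> var_subgroup"
    using c unfolding var_prod_def
    by (intro var_subgroup_iso join_iso join_CV pos_to_ineq_CV A B) (simp_all add: complementary_shift)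
  ultimately show ?thesis
    by (simp add: sign_value_def var_subgroup_closed)
qed

text \<open>The value of a monomial. The product of varieties is commutative only up to isomorphism, so a
  monomial has to be evaluated along some enumeration of its factors; another enumeration changes the
  value by an element of \<^const>\<open>var_subgroup\<close>.\<close>

definition list_value :: "bsa_formula list \<Rightarrow> (bsa_formula \<Rightarrow>\<^sub>0 int)" where
  "list_value As = foldr (\<lambda>A x. vmul (sign_value A) x) As (frag_of empty_formula)"

lemma list_value_simps [simp]:
  "list_value [] = frag_of empty_formula" "list_value (A # As) = vmul (sign_value A) (list_value As)"
  by (simp_all add: list_value_def)

lemma list_value_append: "list_value (As @ Bs) = vmul (list_value As) (list_value Bs)"
  by (induction As) (simp_all add: vmul_assoc)

lemma list_value_closed: "set As \<subseteq> bsa_formulas \<Longrightarrow> list_value As \<in> VF"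
  by (induction As) (simp_all add: sign_value_closed)

lemma list_value_perm:
  assumes "mset As = mset Bs" "set As \<subseteq> bsa_formulas"
  shows "list_value As - list_value Bs \<in> var_subgroup"
  using assms
proof (induction As arbitrary: Bs)
  case (Cons A As)
  have "A \<in> set Bs" using Cons.prems(1) by (metis list.set_intros(1) set_mset_mset)
  then obtain Cs Ds where Bs: "Bs = Cs @ A # Ds" by (meson split_list)
  then have m: "mset As = mset (Cs @ Ds)" using Cons.prems(1) by simp
  have sets: "set Cs \<subseteq> bsa_formulas" "set Ds \<subseteq> bsa_formulas" "A \<in> bsa_formulas"
    using Cons.prems(2) mset_eq_setD[OF Cons.prems(1)] Bs by auto
  let ?a = "sign_value A"
  note cl = sign_value_closed[OF sets(3)] list_value_closed[OF sets(1)] list_value_closed[OF sets(2)]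
  have "vmul ?a (list_value As - list_value (Cs @ Ds)) \<in> var_subgroup"
    using Cons.IH[OF m] Cons.prems(2) by (intro var_subgroup_mult_left cl) auto
  moreover have "vmul (vmul ?a (list_value Cs) - vmul (list_value Cs) ?a) (list_value Ds) \<in> var_subgroup"
    by (intro var_subgroup_mult_right var_subgroup_commute cl)
  ultimately have "vmul ?a (list_value As - list_value (Cs @ Ds)) +
      vmul (vmul ?a (list_value Cs) - vmul (list_value Cs) ?a) (list_value Ds) \<in> var_subgroup"
    by (rule var_subgroup_closed(3))
  then show ?case by (simp add: Bs list_value_append vmul_assoc)
qed (simp add: var_subgroup_closed)

definition monomial_value :: "bsa_formula multiset \<Rightarrow> (bsa_formula \<Rightarrow>\<^sub>0 int)" where
  "monomial_value M = list_value (SOME As. mset As = M)"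

lemma monomial_value_mset:
  assumes "set As \<subseteq> bsa_formulas"
  shows "monomial_value (mset As) - list_value As \<in> var_subgroup"
proof -
  define Bs where "Bs = (SOME Bs. mset Bs = mset As)"
  have m: "mset Bs = mset As" unfolding Bs_def by (rule someI) (rule refl)
  moreover have "set Bs \<subseteq> bsa_formulas" using assms mset_eq_setD[OF m] by simp
  ultimately have "list_value Bs - list_value As \<in> var_subgroup" by (rule list_value_perm)
  then show ?thesis by (simp only: monomial_value_def Bs_def)
qed

lemma monomial_value_simps: "monomial_value {#} = frag_of empty_formula"
  "monomial_value {#A#} = sign_value A"
  by (simp_all add: monomial_value_def)

lemma monomial_value_closed: 
  assumes "set_mset M \<subseteq> bsa_formulas" shows "monomial_value M \<in> VF"
proof -
  obtain As where As: "M = mset As" using ex_mset by metis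
  then have "set As \<subseteq> bsa_formulas" using assms by simp
  then have "(monomial_value (mset As) - list_value As) + list_value As \<in> VF"
    using var_subgroup_closed(1) monomial_value_mset list_value_closed by (intro VF_closed(2)) blast+
  then show ?thesis by (simp add: As)
qed

lemma monomial_value_add:
  assumes "set_mset M \<subseteq> bsa_formulas" "set_mset N \<subseteq> bsa_formulas"
  shows "monomial_value (M + N) - vmul (monomial_value M) (monomial_value N) \<in> var_subgroup"
proof -
  obtain As Bs where As: "M = mset As" and Bs: "N = mset Bs" using ex_mset by metis
  have sets: "set As \<subseteq> bsa_formulas" "set Bs \<subseteq> bsa_formulas" using assms As Bs by auto
  let ?a = "monomial_value M" and ?b = "monomial_value N"
  let ?x = "list_value As" and ?y = "list_value Bs"
  have "vmul (?a - ?x) ?b \<in> var_subgroup"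
    using monomial_value_mset[OF sets(1)] As
    by (intro var_subgroup_mult_right monomial_value_closed assms) simp
  moreover have "vmul ?x (?b - ?y) \<in> var_subgroup"
    using monomial_value_mset[OF sets(2)] Bs
    by (intro var_subgroup_mult_left list_value_closed sets) simp
  moreover have "monomial_value (M + N) - list_value (As @ Bs) \<in> var_subgroup"
    using monomial_value_mset[of "As @ Bs"] sets As Bs by simp
  ultimately have "(monomial_value (M + N) - list_value (As @ Bs)) -
      (vmul (?a - ?x) ?b + vmul ?x (?b - ?y)) \<in> var_subgroup"
    by - (assumption | rule var_subgroup_closed(3,4))+
  then show ?thesis by (simp add: list_value_append)
qed

abbreviation retract :: "(bsa_formula multiset \<Rightarrow>\<^sub>0 int) \<Rightarrow> (bsa_formula \<Rightarrow>\<^sub>0 int)" where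
  "retract \<equiv> frag_extend monomial_value"

lemma retract_symbol [simp]: "retract (bsa_symbol A) = sign_value A"
  by (simp add: bsa_symbol_def monomial_value_simps)

lemma retract_one [simp]: "retract 1 = frag_of empty_formula"
  using frag_extend_of[of monomial_value "{#}"] by (simp add: monomial_value_simps)

lemma BF_induct [consumes 1, case_names of diff zero]:
  assumes "x \<in> BF" "\<And>M. set_mset M \<subseteq> bsa_formulas \<Longrightarrow> P (frag_of M)"
    "\<And>a b. P a \<Longrightarrow> P b \<Longrightarrow> P (a - b)" "P 0"
  shows "P x"
  by (rule frag_induct[of x "{M. set_mset M \<subseteq> bsa_formulas}"])
    (use assms in \<open>auto simp: bsa_free_def mpoly_ring_carrier_iff\<close>)

lemma retract_closed: "x \<in> BF \<Longrightarrow> retract x \<in> VF"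
  by (induction x rule: BF_induct) (simp_all add: monomial_value_closed frag_extend_diff)

lemma retract_mult:
  assumes "x \<in> BF" "y \<in> BF"
  shows "retract (x * y) - vmul (retract x) (retract y) \<in> var_subgroup"
  using assms(1)
proof (induction x rule: BF_induct)
  case (of M)
  from assms(2) show ?case
  proof (induction y rule: BF_induct)
    case N: (of N)
    then show ?case using of by (simp add: mult_single monomial_value_add)
  next
    case (diff a b)
    from var_subgroup_closed(4)[OF this] show ?case by (simp add: algebra_simps frag_extend_diff)
  qed (simp add: var_subgroup_closed)
next
  case (diff a b)
  from var_subgroup_closed(4)[OF this] show ?case by (simp add: algebra_simps frag_extend_diff)
qed (simp add: var_subgroup_closed)

lemma retract_relations:
  assumes "r \<in> bsa_relations" shows "retract r \<in> var_subgroup"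
  using assms unfolding bsa_relations_def
proof (elim UnE CollectE exE conjE)
  fix A B assume "r = bsa_symbol A - bsa_symbol B" "A \<in> bsa_formulas" "B \<in> bsa_formulas"
    "pos A = {}" "pos B = {}" "iso_over_real A B"
  then show ?thesis
    by (simp add: frag_extend_diff sign_value_CV var_subgroup_iso constructible_varieties_def)
next
  fix A S assume "r = bsa_symbol A - (bsa_symbol (with_eq A S) + bsa_symbol (with_ineq A S))"
    "A \<in> bsa_formulas" "S \<in> Rpoly (nvars A)"
  then show ?thesis by (simp add: frag_extend_diff frag_extend_add sign_value_split)
next
  fix A R assume "r = bsa_symbol (with_ineq A R) - (bsa_symbol (with_pos A R) + bsa_symbol (with_pos A (- R)))"
    "A \<in> bsa_formulas" "R \<in> Rpoly (nvars A)"
  then show ?thesis by (simp add: frag_extend_diff frag_extend_add sign_value_sign)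
next
  fix \<sigma> A \<tau> B assume r: "r = bsa_symbol (join \<sigma> A \<tau> B) - bsa_symbol A * bsa_symbol B"
    and AB: "A \<in> bsa_formulas" "B \<in> bsa_formulas"
    and mono: "strict_mono_on {..<nvars A} \<sigma>" "strict_mono_on {..<nvars B} \<tau>"
    and "\<sigma> ` {..<nvars A} \<inter> \<tau> ` {..<nvars B} = {}"
      "\<sigma> ` {..<nvars A} \<union> \<tau> ` {..<nvars B} = {..<nvars A + nvars B}"
  then have "sign_value (join \<sigma> A \<tau> B) - vmul (sign_value A) (sign_value B) \<in> var_subgroup"
    by (intro sign_value_join strict_mono_on_complementary)
  moreover have "retract (bsa_symbol A * bsa_symbol B) - vmul (sign_value A) (sign_value B) \<in> var_subgroup"
    using retract_mult[of "bsa_symbol A" "bsa_symbol B"] AB by simp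
  ultimately have "(sign_value (join \<sigma> A \<tau> B) - vmul (sign_value A) (sign_value B)) -
      (retract (bsa_symbol A * bsa_symbol B) - vmul (sign_value A) (sign_value B)) \<in> var_subgroup"
    by (rule var_subgroup_closed(4))
  then show ?thesis by (simp add: r frag_extend_diff)
next
  assume "r \<in> {bsa_symbol empty_formula - 1}"
  then show ?thesis
    by (simp add: frag_extend_diff sign_value_CV var_subgroup_closed)
qed

lemma retract_bsa_ideal:
  assumes "x \<in> bsa_ideal" shows "retract x \<in> var_subgroup"
proof -
  let ?J = "{x \<in> BF. retract x \<in> var_subgroup}"
  have "ideal ?J bsa_free"
    unfolding bsa_free_def mpoly_ideal_iff
    unfolding bsa_free_def[symmetric]
  proof (intro conjI ballI)
    fix a x assume a: "a \<in> ?J" and x: "x \<in> BF"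
    have "(retract (x * a) - vmul (retract x) (retract a)) + vmul (retract x) (retract a) \<in> var_subgroup"
      using a x by (intro var_subgroup_closed(3) retract_mult var_subgroup_mult_left retract_closed) auto
    then show "x * a \<in> ?J" using a x by simp
  qed (auto simp: frag_extend_add var_subgroup_closed)
  moreover have "bsa_relations \<subseteq> ?J" using retract_relations bsa_relations_closed by auto
  ultimately have "bsa_ideal \<subseteq> ?J"
    unfolding bsa_ideal_def by (rule bf.genideal_minimal)
  then show ?thesis using assms by auto
qed

lemma retract_symbol_extend: "x \<in> VF \<Longrightarrow> retract (symbol_extend x) = x"
  by (induction x rule: VF_induct) (simp_all add: frag_extend_diff sign_value_CV)

section \<open>Injectivity\<close>

lemma bsa_coset_eq_iff:
  assumes "x \<in> BF" "y \<in> BF"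
  shows "bsa_ideal +>\<^bsub>bsa_free\<^esub> x = bsa_ideal +>\<^bsub>bsa_free\<^esub> y \<longleftrightarrow> x - y \<in> bsa_ideal"
  using bf.quotient_eq_iff_same_a_r_cos[OF bsa_ideal_ideal assms] assms
  by (simp add: bsa_free_def mpoly_ring_a_minus)

lemma natural_hom:
  "ring_hom_ring var_free K0_BSA (\<lambda>x. bsa_ideal +>\<^bsub>bsa_free\<^esub> symbol_extend x)"
proof -
  interpret q: ring_hom_ring bsa_free K0_BSA "\<lambda>x. bsa_ideal +>\<^bsub>bsa_free\<^esub> x"
    unfolding K0_BSA_def by (rule ideal.rcos_ring_hom_ring[OF bsa_ideal_ideal])
  show ?thesis
  proof (rule ring_hom_ringI2[OF var_free_ring q.S.ring_axioms], rule ring_hom_memI)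
    fix x y assume xy: "x \<in> VF" "y \<in> VF"
    have cl: "symbol_extend x \<in> BF" "symbol_extend y \<in> BF" using symbol_extend_closed xy by auto
    show "bsa_ideal +>\<^bsub>bsa_free\<^esub> symbol_extend x \<in> carrier K0_BSA"
      by (rule q.hom_closed[OF cl(1)])
    show "bsa_ideal +>\<^bsub>bsa_free\<^esub> symbol_extend (x \<oplus>\<^bsub>var_free\<^esub> y) =
        (bsa_ideal +>\<^bsub>bsa_free\<^esub> symbol_extend x) \<oplus>\<^bsub>K0_BSA\<^esub> (bsa_ideal +>\<^bsub>bsa_free\<^esub> symbol_extend y)"
      using q.hom_add[OF cl] by (simp add: frag_extend_add)
    have "bsa_ideal +>\<^bsub>bsa_free\<^esub> symbol_extend (vmul x y) =
        bsa_ideal +>\<^bsub>bsa_free\<^esub> (symbol_extend x * symbol_extend y)"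
      using xy cl symbol_extend_closed[OF vmul_closed[OF xy]] symbol_extend_mult[OF xy]
      by (subst bsa_coset_eq_iff) simp_all
    then show "bsa_ideal +>\<^bsub>bsa_free\<^esub> symbol_extend (x \<otimes>\<^bsub>var_free\<^esub> y) =
        (bsa_ideal +>\<^bsub>bsa_free\<^esub> symbol_extend x) \<otimes>\<^bsub>K0_BSA\<^esub> (bsa_ideal +>\<^bsub>bsa_free\<^esub> symbol_extend y)"
      using q.hom_mult[OF cl] by simp
  next
    have "bsa_symbol empty_formula - 1 \<in> bsa_ideal"
      by (rule bsa_relations_in_ideal) (simp add: bsa_relations_def)
    then have "bsa_ideal +>\<^bsub>bsa_free\<^esub> bsa_symbol empty_formula = bsa_ideal +>\<^bsub>bsa_free\<^esub> 1"
      by (subst bsa_coset_eq_iff) simp_all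
    then show "bsa_ideal +>\<^bsub>bsa_free\<^esub> symbol_extend \<one>\<^bsub>var_free\<^esub> = \<one>\<^bsub>K0_BSA\<^esub>"
      using q.hom_one by simp
  qed
qed

interpretation nh: ring_hom_ring var_free K0_BSA "\<lambda>x. bsa_ideal +>\<^bsub>bsa_free\<^esub> symbol_extend x"
  by (rule natural_hom)

text \<open>The kernel contains the relations of varieties; conversely, the left inverse recovers an element of the
  kernel, up to these relations, from an element of \<^const>\<open>bsa_ideal\<close>.\<close>

lemma natural_hom_kernel:
  "a_kernel var_free K0_BSA (\<lambda>x. bsa_ideal +>\<^bsub>bsa_free\<^esub> symbol_extend x) = var_subgroup"
proof -
  have zero: "bsa_ideal +>\<^bsub>bsa_free\<^esub> symbol_extend 0 = \<zero>\<^bsub>K0_BSA\<^esub>"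
    using nh.hom_zero by simp
  have "bsa_ideal +>\<^bsub>bsa_free\<^esub> symbol_extend x = \<zero>\<^bsub>K0_BSA\<^esub> \<longleftrightarrow> x \<in> var_subgroup" if x: "x \<in> VF" for x
  proof -
    have "bsa_ideal +>\<^bsub>bsa_free\<^esub> symbol_extend x = \<zero>\<^bsub>K0_BSA\<^esub> \<longleftrightarrow> symbol_extend x \<in> bsa_ideal"
      unfolding zero[symmetric] using symbol_extend_closed[OF x] by (subst bsa_coset_eq_iff) simp_all
    also have "\<dots> \<longleftrightarrow> x \<in> var_subgroup"
      using symbol_extend_var_subgroup retract_bsa_ideal[of "symbol_extend x"] retract_symbol_extend[OF x] by auto
    finally show ?thesis .
  qed
  then show ?thesis
    using var_subgroup_closed(1) unfolding a_kernel_def' by blast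
qed

theorem proposition1p3p3:
  shows "(\<forall>X \<in> constructible_varieties. natural_map (var_class X) = bsa_class X) \<and>
    ring_hom_cring K0_Var K0_BSA natural_map \<and>
    inj_on natural_map (carrier K0_Var)"
proof (intro conjI ballI)
  let ?h = "\<lambda>x. bsa_ideal +>\<^bsub>bsa_free\<^esub> symbol_extend x"
  have nat_map: "natural_map = (\<lambda>c. the_elem (?h ` c))"
    by (simp add: natural_map_def fun_eq_iff)
  show "natural_map (var_class X) = bsa_class X" if "X \<in> CV" for X
    using nh.the_elem_simp[of "frag_of X"] that
    by (simp add: nat_map var_class_def bsa_class_def natural_hom_kernel)
  show inj: "inj_on natural_map (carrier K0_Var)"
    using nh.the_elem_inj unfolding natural_hom_kernel K0_Var_def[symmetric] nat_map
    by (intro inj_onI)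
  have hom: "natural_map \<in> ring_hom K0_Var K0_BSA"
    using nh.the_elem_hom unfolding natural_hom_kernel K0_Var_def[symmetric] nat_map .
  have K0_BSA: "cring K0_BSA"
    unfolding K0_BSA_def by (rule ideal.quotient_is_cring[OF bsa_ideal_ideal bsa_free_cring])
  interpret B: cring K0_BSA by (rule K0_BSA)
  interpret V: ring K0_Var
    using ideal.quotient_is_ring[OF nh.kernel_is_ideal]
    unfolding natural_hom_kernel K0_Var_def[symmetric] .
  have K0_Var: "cring K0_Var"
  proof (intro cring.intro comm_monoid.intro comm_monoid_axioms.intro V.ring_axioms V.monoid_axioms)
    fix x y assume xy: "x \<in> carrier K0_Var" "y \<in> carrier K0_Var"
    have "natural_map (x \<otimes>\<^bsub>K0_Var\<^esub> y) = natural_map (y \<otimes>\<^bsub>K0_Var\<^esub> x)"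
      using ring_hom_mult[OF hom] ring_hom_closed[OF hom] xy B.m_comm by simp
    then show "x \<otimes>\<^bsub>K0_Var\<^esub> y = y \<otimes>\<^bsub>K0_Var\<^esub> x"
      using inj_onD[OF inj] xy by simp
  qed
  show "ring_hom_cring K0_Var K0_BSA natural_map"
    by (intro ring_hom_cringI ring_hom_ringI2 V.ring_axioms cring.axioms(1)[OF K0_BSA] hom K0_Var K0_BSA)
qed

end
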